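(* Let $0<p<1$, let $w>0$ be real, and let $a\ne0$ be complex with $|\arg a|<\tfrac12\pi$. Then $$\sum_{n=1}^\infty\frac{e^{-an^p}}{n^w}=J_p(a;w)+\sum_{k=0}^{\infty}{}^{'}\,\frac{(-1)^k}{k!}\,\zeta(w-kp)\,a^k,$$ the series on the right being convergent, where $$J_p(a;w)=\begin{cases}\dfrac1p\,\Gamma\Bigl(\dfrac{1-w}{p}\Bigr)a^{(w-1)/p}&\text{if } w\ne pM+1 \text{ for all integers } M\ge0,\\[2ex]\dfrac{(-a)^M}{M!}\Bigl\{\gamma-\dfrac1p\log a+\dfrac1p\,\psi(M+1)\Bigr\}&\text{if } w=pM+1 \text{ for an integer } M\ge0,\end{cases}$$ and the prime on the sum denotes the omission of the term $k=M$ when $w=pM+1$.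
   Context: $\zeta$ is the Riemann zeta function, $\gamma$ is Euler's constant, $\psi$ is the logarithmic derivative of the gamma function; powers and logarithms of $a$ are principal values. *)

theory Defs
  imports "HOL-Complex_Analysis.Complex_Analysis"
begin

text \<open>
  The Riemann zeta function: the holomorphic continuation of the Dirichlet series
  to the punctured plane, unique by the identity theorem once the (immaterial) value
  at the pole is fixed to be 0.
\<close>

definition zeta :: "complex \<Rightarrow> complex" where
  "zeta = (THE f. f holomorphic_on - {1} \<and> f 1 = 0 \<and>
             (\<forall>s. Re s > 1 \<longrightarrow> (\<lambda>n. 1 / of_nat (Suc n) powr s) sums f s))"

text \<open>For \<open>p \<noteq> 0\<close> at most one \<open>M\<close> satisfies \<open>w = p * M + 1\<close>.\<close>

definition J :: "real \<Rightarrow> complex \<Rightarrow> real \<Rightarrow> complex" where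
  "J p a w =
     (if \<forall>M::nat. w \<noteq> p * real M + 1
      then 1 / of_real p * Gamma (of_real ((1 - w) / p)) * a powr of_real ((w - 1) / p)
      else let M = (THE M::nat. w = p * real M + 1) in
        (- a) ^ M / fact M *
          (euler_mascheroni - 1 / of_real p * Ln a + 1 / of_real p * Digamma (of_nat (M + 1))))"

end

theory Submission
  imports Defs
begin

text \<open>
  The key is a summation formula with an explicit, rapidly convergent remainder. If \<open>F\<close> is holomorphic in
  the right half plane and of moderate growth, let \<open>vertical_mean F x\<close> be the mean of \<open>F (x + \<i>
  y)\<close> over \<open>y\<close> with weight \<open>\<pi> / (2 cosh\<^sup>2 (\<pi> y))\<close>. On the lines
  \<open>Re z = n \<plusminus> 1/2\<close> this weight is \<open>1 / sin\<^sup>2 (\<pi> z)\<close> up to a constant,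
  so the residue theorem gives \<open>vertical_mean F (n + 1/2) - vertical_mean F (n - 1/2) = F' n\<close>
  (\<open>vertical_mean_step\<close>). Summing over \<open>n\<close>, and provided that \<open>F'\<close> tends to 0,
  the difference between the sum of \<open>F' n\<close> over \<open>1 \<le> n \<le> N\<close> and \<open>F (N +
  1/2)\<close> tends to \<open>- vertical_mean F (1/2)\<close> (\<open>sum_minus_antiderivative_tendsto\<close>).

  For \<open>F z = z powr (1 - s) / (1 - s)\<close> this is Jensen's formula: \<open>- zeta s\<close> is the mean of
  \<open>F\<close> on the line \<open>Re z = 1/2\<close>, first for \<open>Re s > 1\<close> and then for all \<open>s
  \<noteq> 1\<close>, since the mean continues analytically (\<open>zeta_eq_vertical_mean\<close>). For \<open>F =
  Ln\<close> the mean is \<open>- euler_mascheroni\<close> (\<open>vertical_mean_Ln\<close>).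

  Now let \<open>F\<close> be the antiderivative of \<open>exp (- a * z powr p) * z powr (- w)\<close> obtained by
  termwise integration of the exponential series. Its terms are multiples of \<open>z powr (1 - s) / (1 - s)\<close>
  with \<open>s = w - k * p\<close>, or of \<open>Ln a + p * Ln z\<close> for the exceptional \<open>k\<close>.
  Because \<open>p < 1\<close>, the whole series is dominated on the line \<open>Re z = 1/2\<close> by a function that
  the weight makes integrable, so mean and sum may be exchanged (\<open>vertical_mean_summand_prim_sums\<close>):
  \<open>- vertical_mean F (1/2)\<close> is the series of zeta values, which thereby converges, together with the
  terms with Euler's constant and \<open>Ln a\<close> in the exceptional case.

  What remains is the limit of \<open>F\<close> at infinity. The substitution \<open>u = a * z powr p\<close> turns
  \<open>F\<close> into a lower incomplete gamma function with exponent \<open>b = (1 - w) / p\<close>, extended to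
  all real \<open>b\<close> by its series (\<open>gamma_prim\<close>). Its limit along rays in the right half plane is
  \<open>Gamma b\<close>, or \<open>(-1) ^ M / fact M * Digamma (M + 1)\<close> when \<open>b = - M\<close>
  (\<open>gamma_prim_tendsto_Gamma\<close>, \<open>gamma_prim_tendsto_Digamma\<close>,
  \<open>gamma_prim_tendsto_along_ray\<close>): for \<open>b > 0\<close> this is Euler's integral, for \<open>b =
  0\<close> it follows by letting \<open>b\<close> tend to 0 from above, and integration by parts lowers
  \<open>b\<close> by 1.
\<close>

section \<open>Means along vertical lines\<close>

text \<open>
  The density is a constant times \<open>1 / sin\<^sup>2 (\<pi> z)\<close>, restricted to any vertical line
  \<open>Re z = n + 1/2\<close>: there \<open>sin\<^sup>2 (\<pi> z) = cosh\<^sup>2 (\<pi> y)\<close>.  The constant makes the total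
  mass 1.
\<close>
definition sech_measure :: "real measure" where
  "sech_measure = density lborel (\<lambda>y. pi / 2 / (cosh (pi * y))\<^sup>2)"

definition vertical_mean :: "(complex \<Rightarrow> complex) \<Rightarrow> real \<Rightarrow> complex" where
  "vertical_mean F x = (LINT y|sech_measure. F (Complex x y))"

text \<open>
  The density decays like \<open>exp (-2 \<pi> \<bar>y\<bar>)\<close>, so growth like \<open>exp (norm z)\<close> leaves ample room
  both for integrability and for the horizontal edges of the contour to disappear.
\<close>
definition tame :: "(complex \<Rightarrow> complex) \<Rightarrow> bool" where
  "tame F \<longleftrightarrow> F holomorphic_on {z. Re z > 0} \<and>
     (\<exists>K. \<forall>z. Re z \<ge> 1/2 \<longrightarrow> norm (F z) \<le> K * exp (norm z))"

lemma sets_sech_measure [measurable_cong, simp]: "sets sech_measure = sets borel"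
  by (simp add: sech_measure_def)

lemma space_sech_measure [simp]: "space sech_measure = UNIV"
  by (simp add: sech_measure_def)

lemma sech_squared_integral:
  assumes c: "c > 0"
  shows "integrable lborel (\<lambda>y. 1 / (cosh (c * y))\<^sup>2 :: real)"
    and "(LINT y|lborel. 1 / (cosh (c * y))\<^sup>2) = 2 / c"
proof -
  let ?f = "\<lambda>y::real. 1 / (cosh (c * y))\<^sup>2" and ?F = "\<lambda>y::real. tanh (c * y) / c"
  have d: "(?F has_real_derivative ?f x) (at x)" for x
  proof -
    have "1 - (tanh (c * x))\<^sup>2 = ((cosh (c * x))\<^sup>2 - (sinh (c * x))\<^sup>2) / (cosh (c * x))\<^sup>2"
      by (simp add: tanh_def power_divide diff_divide_distrib)
    then have "1 - (tanh (c * x))\<^sup>2 = 1 / (cosh (c * x))\<^sup>2"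
      by (simp add: cosh_square_eq)
    then show ?thesis using c by (auto intro!: derivative_eq_intros)
  qed
  have cont: "isCont ?f x" for x by (intro continuous_intros) auto
  have "(?F \<longlongrightarrow> 1 / c) at_top"
    using c
    by (intro tendsto_intros filterlim_compose[OF tanh_real_at_top]
          filterlim_tendsto_pos_mult_at_top[OF tendsto_const] filterlim_ident) auto
  then have top: "((?F \<circ> real_of_ereal) \<longlongrightarrow> 1 / c) (at_left \<infinity>)"
    by (simp add: ereal_tendsto_simps1)
  have "(?F \<longlongrightarrow> -1 / c) at_bot"
    using c
    by (intro tendsto_intros filterlim_compose[OF tanh_real_at_bot]
          filterlim_tendsto_pos_mult_at_bot[OF tendsto_const] filterlim_ident) auto
  then have bot: "((?F \<circ> real_of_ereal) \<longlongrightarrow> -1 / c) (at_right (-\<infinity>))"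
    by (simp add: ereal_tendsto_simps1)
  have "set_integrable lborel (einterval (-\<infinity>) \<infinity>) ?f" "(LBINT x=-\<infinity>..\<infinity>. ?f x) = 1 / c - (-1 / c)"
    by (rule interval_integral_FTC_nonneg[where F = ?F]; use d cont top bot in simp)+
  then show "integrable lborel ?f" "(LINT y|lborel. ?f y) = 2 / c"
    by (simp_all add: set_integrable_def interval_lebesgue_integral_def set_lebesgue_integral_def
        einterval_def)
qed

lemma measurable_sech [measurable]: "(\<lambda>y::real. pi / 2 / (cosh (pi * y))\<^sup>2) \<in> borel_measurable borel"
  by (intro borel_measurable_continuous_onI continuous_intros) auto

lemma
  fixes f :: "real \<Rightarrow> 'a :: {banach, second_countable_topology}"
  assumes "f \<in> borel_measurable borel"
  shows integrable_sech_measure_iff: "integrable sech_measure f \<longleftrightarrow>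
          integrable lborel (\<lambda>y. (pi / 2 / (cosh (pi * y))\<^sup>2) *\<^sub>R f y)"
    and integral_sech_measure: "(LINT y|sech_measure. f y) =
          (LINT y|lborel. (pi / 2 / (cosh (pi * y))\<^sup>2) *\<^sub>R f y)"
proof -
  have "f \<in> borel_measurable lborel" "(\<lambda>y::real. pi / 2 / (cosh (pi * y))\<^sup>2) \<in> borel_measurable lborel"
    using assms measurable_sech by simp_all
  then show "integrable sech_measure f \<longleftrightarrow>
          integrable lborel (\<lambda>y. (pi / 2 / (cosh (pi * y))\<^sup>2) *\<^sub>R f y)"
    "(LINT y|sech_measure. f y) = (LINT y|lborel. (pi / 2 / (cosh (pi * y))\<^sup>2) *\<^sub>R f y)"
    unfolding sech_measure_def by (intro integrable_density integral_density; simp)+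
qed

lemma sech_measure_const [simp]:
  "integrable sech_measure (\<lambda>y. c :: complex)" "(LINT y|sech_measure. c) = (c :: complex)"
proof -
  have eq: "(\<lambda>y. (pi / 2 / (cosh (pi * y))\<^sup>2) *\<^sub>R c) = (\<lambda>y. (1 / (cosh (pi * y))\<^sup>2) *\<^sub>R ((pi / 2) *\<^sub>R c))"
    by (simp add: fun_eq_iff)
  show "integrable sech_measure (\<lambda>y. c)"
    by (simp only: integrable_sech_measure_iff[OF borel_measurable_const] eq)
       (intro integrable_scaleR_left sech_squared_integral(1) pi_gt_zero)
  show "(LINT y|sech_measure. c) = c"
    unfolding integral_sech_measure[OF borel_measurable_const] eq
      integral_scaleR_left[OF sech_squared_integral(1)[OF pi_gt_zero]]
    by (simp add: sech_squared_integral(2)[OF pi_gt_zero])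
qed

lemma integrable_sech_measure_exp: "integrable sech_measure (\<lambda>y. exp (2 * \<bar>y\<bar>))"
proof -
  have "integrable lborel (\<lambda>y. (pi / 2 / (cosh (pi * y))\<^sup>2) *\<^sub>R exp (2 * \<bar>y\<bar>))"
  proof (rule Bochner_Integration.integrable_bound)
    show "integrable lborel (\<lambda>y::real. (2 * pi) * (1 / (cosh (1 * y))\<^sup>2))"
      by (intro integrable_mult_right sech_squared_integral(1)) simp
    show "AE y in lborel. norm ((pi / 2 / (cosh (pi * y))\<^sup>2) *\<^sub>R exp (2 * \<bar>y\<bar>))
            \<le> norm ((2 * pi) * (1 / (cosh (1 * y))\<^sup>2))"
    proof (intro AE_I2)
      fix y :: real
      \<comment> \<open>comparison with \<open>1 / (cosh y)\<^sup>2\<close>, which is integrable, because \<open>2 + 2 \<le> 2 * pi\<close>\<close>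
      have "exp (pi * \<bar>y\<bar>) / 2 \<le> cosh (pi * \<bar>y\<bar>)"
        by (simp add: cosh_def)
      also have "\<dots> = cosh (pi * y)"
        by (metis abs_mult abs_of_pos cosh_real_abs pi_gt_zero)
      finally have "(exp (pi * \<bar>y\<bar>) / 2)\<^sup>2 \<le> (cosh (pi * y))\<^sup>2"
        by (intro power_mono) auto
      then have 1: "exp (2 * pi * \<bar>y\<bar>) \<le> 4 * (cosh (pi * y))\<^sup>2"
        by (simp add: power_divide exp_double [symmetric] mult.assoc)
      have "cosh \<bar>y\<bar> \<le> exp \<bar>y\<bar>"
        using exp_le_cancel_iff[of "- \<bar>y\<bar>" "\<bar>y\<bar>"] unfolding cosh_def by simp
      then have "(cosh y)\<^sup>2 \<le> (exp \<bar>y\<bar>)\<^sup>2"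
        by (intro power_mono) auto
      then have "exp (2 * \<bar>y\<bar>) * (cosh y)\<^sup>2 \<le> exp (2 * \<bar>y\<bar>) * exp (2 * \<bar>y\<bar>)"
        unfolding exp_double[of "\<bar>y\<bar>"] by (intro mult_left_mono) auto
      also have "\<dots> \<le> exp (2 * pi * \<bar>y\<bar>)"
        using pi_gt3 mult_right_mono[of 2 pi "\<bar>y\<bar>"] by (simp add: exp_add[symmetric])
      also note 1
      finally have "exp (2 * \<bar>y\<bar>) * (cosh y)\<^sup>2 \<le> 4 * (cosh (pi * y))\<^sup>2" .
      then show "norm ((pi / 2 / (cosh (pi * y))\<^sup>2) *\<^sub>R exp (2 * \<bar>y\<bar>))
            \<le> norm ((2 * pi) * (1 / (cosh (1 * y))\<^sup>2))"
        by (simp add: field_simps)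
    qed
  qed measurable
  then show ?thesis
    by (subst integrable_sech_measure_iff) auto
qed

lemma measurable_vertical:
  fixes F :: "complex \<Rightarrow> complex"
  assumes "continuous_on {z. Re z > 0} F" "x > 0"
  shows "(\<lambda>y. F (Complex x y)) \<in> borel_measurable borel"
proof (intro borel_measurable_continuous_onI continuous_on_compose2[OF assms(1)])
  show "continuous_on UNIV (Complex x)"
    unfolding Complex_eq by (intro continuous_intros)
qed (use assms in auto)

lemma integrable_vertical:
  fixes F :: "complex \<Rightarrow> complex"
  assumes "continuous_on {z. Re z > 0} F" "x > 0" "\<And>y. norm (F (Complex x y)) \<le> K * exp (2 * \<bar>y\<bar>)"
  shows "integrable sech_measure (\<lambda>y. F (Complex x y))"
proof (rule Bochner_Integration.integrable_bound)
  show "integrable sech_measure (\<lambda>y. K * exp (2 * \<bar>y\<bar>))"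
    by (intro integrable_mult_right integrable_sech_measure_exp)
  show "(\<lambda>y. F (Complex x y)) \<in> borel_measurable sech_measure"
    using measurable_vertical[OF assms(1,2)] by (simp cong: measurable_cong_sets)
  show "AE y in sech_measure. norm (F (Complex x y)) \<le> norm (K * exp (2 * \<bar>y\<bar>))"
    by (intro AE_I2) (metis abs_ge_self assms(3) order_trans real_norm_def)
qed

lemma tame_bound:
  assumes "tame F"
  obtains K where "K \<ge> 0" "\<And>x y. x \<ge> 1/2 \<Longrightarrow> norm (F (Complex x y)) \<le> K * exp x * exp (2 * \<bar>y\<bar>)"
proof -
  from assms obtain K where "\<forall>z. Re z \<ge> 1/2 \<longrightarrow> norm (F z) \<le> K * exp (norm z)"
    unfolding tame_def by (elim conjE exE)
  note K = this[rule_format]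
  have "0 \<le> K * exp (norm (1::complex))"
    by (rule order_trans[OF norm_ge_zero K]) simp
  then have K0: "K \<ge> 0" by (simp add: zero_le_mult_iff)
  show ?thesis
  proof (rule that[OF K0])
    fix x y :: real assume x: "x \<ge> 1/2"
    have "norm (F (Complex x y)) \<le> K * exp (norm (Complex x y))"
      using x by (intro K) simp
    also have "norm (Complex x y) \<le> x + 2 * \<bar>y\<bar>"
      using cmod_le[of "Complex x y"] x by simp
    then have "K * exp (norm (Complex x y)) \<le> K * exp (x + 2 * \<bar>y\<bar>)"
      using K0 by (intro mult_left_mono) auto
    finally show "norm (F (Complex x y)) \<le> K * exp x * exp (2 * \<bar>y\<bar>)"
      by (simp only: exp_add mult.assoc)
  qed
qed

lemma tame_integrable:
  assumes "tame F" "x \<ge> 1/2"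
  shows "integrable sech_measure (\<lambda>y. F (Complex x y))"
proof -
  obtain K where "\<And>x y. x \<ge> 1/2 \<Longrightarrow> norm (F (Complex x y)) \<le> K * exp x * exp (2 * \<bar>y\<bar>)"
    using tame_bound[OF assms(1)] by metis
  with assms show ?thesis
    by (intro integrable_vertical[of _ _ "K * exp x"])
       (auto simp: tame_def holomorphic_on_imp_continuous_on)
qed

text \<open>
  Contour integrals live on bounded segments; this connects them with the mean over the
  whole line.
\<close>
lemma vertical_segment_tendsto:
  assumes "tame F" "x \<ge> 1/2"
  shows "(\<lambda>N. integral {- real N..real N} (\<lambda>y. F (Complex x y) * of_real (pi / 2 / (cosh (pi * y))\<^sup>2)))
           \<longlonglongrightarrow> vertical_mean F x"
proof -
  let ?f = "\<lambda>y. (pi / 2 / (cosh (pi * y))\<^sup>2) *\<^sub>R F (Complex x y)"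
  have meas: "(\<lambda>y. F (Complex x y)) \<in> borel_measurable borel"
    using assms by (intro measurable_vertical) (auto simp: tame_def holomorphic_on_imp_continuous_on)
  have int: "integrable lborel ?f"
    using tame_integrable[OF assms] integrable_sech_measure_iff[OF meas] by simp
  have vm: "vertical_mean F x = integral\<^sup>L lborel ?f"
    unfolding vertical_mean_def by (rule integral_sech_measure[OF meas])
  have "(\<lambda>N. LINT y|lborel. indicator {- real N..real N} y *\<^sub>R ?f y) \<longlonglongrightarrow> integral\<^sup>L lborel ?f"
  proof (rule integral_dominated_convergence[where w = "\<lambda>y. norm (?f y)"])
    show "AE y in lborel. (\<lambda>N. indicator {- real N..real N} y *\<^sub>R ?f y) \<longlonglongrightarrow> ?f y"
    proof (intro AE_I2 tendsto_eventually)
      fix y :: real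
      obtain n where "\<bar>y\<bar> \<le> real n" using real_arch_simple by blast
      then show "\<forall>\<^sub>F N in sequentially. indicator {- real N..real N} y *\<^sub>R ?f y = ?f y"
        by (intro eventually_sequentiallyI[of n]) (auto simp: indicator_def)
    qed
    show "(\<lambda>y. indicator {- real N..real N} y *\<^sub>R ?f y) \<in> borel_measurable lborel" for N
      using borel_measurable_integrable[OF int] by (rule borel_measurable_scaleR[rotated]) simp
    show "integrable lborel (\<lambda>y. norm (?f y))"
      using int by (rule integrable_norm)
    show "AE y in lborel. norm (indicator {- real N..real N} y *\<^sub>R ?f y) \<le> norm (?f y)" for N
      by (intro AE_I2) (simp add: indicator_def)
  qed (rule borel_measurable_integrable[OF int])
  also have "(\<lambda>N. LINT y|lborel. indicator {- real N..real N} y *\<^sub>R ?f y)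
      = (\<lambda>N. integral {- real N..real N} ?f)"
  proof
    fix N
    have "set_integrable lborel {- real N..real N} ?f"
      unfolding set_integrable_def using int by (intro integrable_mult_indicator) auto
    from set_borel_integral_eq_integral(2)[OF this]
    show "(LINT y|lborel. indicator {- real N..real N} y *\<^sub>R ?f y) = integral {- real N..real N} ?f"
      by (simp add: set_lebesgue_integral_def)
  qed
  finally show ?thesis by (simp add: vm scaleR_conv_of_real mult.commute)
qed

section \<open>Summation by residues\<close>
lemma sin_pi_eq_0_strip:
  assumes "sin (of_real pi * z) = 0" "\<bar>Re z - real n\<bar> < 1"
  shows "z = of_nat n"
proof -
  obtain m :: int where m: "of_real pi * z = of_real (real_of_int m * pi)"
    using assms(1) by (auto simp: sin_eq_0)
  then have z: "z = of_int m" by simp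
  with assms(2) have "\<bar>real_of_int (m - int n)\<bar> < 1" by simp
  then have "m = int n" by linarith
  with z show ?thesis by simp
qed

lemma sin_squared_half_line:
  assumes "x = real n + 1/2"
  shows "(sin (of_real pi * Complex x y))\<^sup>2 = of_real ((cosh (pi * y))\<^sup>2)"
proof -
  have c: "cos (2 * (pi * x)) = -1"
  proof -
    have "2 * (pi * x) = real n * (2 * pi) + pi" by (simp add: assms field_simps)
    moreover have "cos (real n * (2 * pi)) = 1" "sin (real n * (2 * pi)) = 0"
      using cos_2npi[of n] sin_2npi[of n] by (simp_all add: mult_ac)
    ultimately show ?thesis by (simp add: cos_add)
  qed
  have "cos (2 * (of_real pi * Complex x y)) = cos (of_real (2 * (pi * x)) + \<i> * of_real (2 * (pi * y)))"
    by (rule arg_cong[of _ _ cos]) (simp add: complex_eq_iff)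
  also have "\<dots> = of_real (- cosh (2 * (pi * y)))"
  proof -
    have "sin (2 * (pi * x)) = 0" using sin_cos_squared_add[of "2 * (pi * x)"] c by simp
    then show ?thesis using c by (simp add: complex_eq_iff Re_cos Im_cos cosh_def field_simps)
  qed
  finally have "cos (2 * (of_real pi * Complex x y)) = of_real (- cosh (2 * (pi * y)))" .
  moreover have "cosh (2 * (pi * y)) = 2 * (cosh (pi * y))\<^sup>2 - 1"
    using cosh_double_cosh[of "pi * y"] by simp
  ultimately show ?thesis
    using cos_double_sin[of "of_real pi * Complex x y"] by simp
qed

lemma norm_sin_squared_ge:
  assumes "N \<ge> (1::nat)" "\<bar>Im z\<bar> = real N"
  shows "norm (sin (of_real pi * z)) ^ 2 \<ge> exp (6 * real N) / 8"
proof -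
  define E where "E = exp (2 * (pi * real N))"
  have "exp (6 * real N) \<le> E"
    unfolding E_def using pi_gt3 assms(1) by simp
  moreover have "exp (6 * real N) \<ge> 4"
  proof -
    have "real N \<ge> 1" using assms(1) by simp
    then show ?thesis using exp_ge_add_one_self[of "6 * real N"] by linarith
  qed
  moreover have "E \<le> exp (2 * Im (of_real pi * z)) + inverse (exp (2 * Im (of_real pi * z)))"
  proof (cases "Im z \<ge> 0")
    case True
    then show ?thesis using assms(2) by (simp add: E_def mult_ac)
  next
    case False
    then have "Im z = - real N" using assms(2) by simp
    then show ?thesis by (simp add: E_def exp_minus)
  qed
  moreover have "cos (2 * Re (of_real pi * z)) \<le> 1" by simp
  moreover have "e / 8 \<le> (t - 2 * u) / 4" if "e \<le> E" "4 \<le> e" "E \<le> t" "u \<le> 1" for e t u :: real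
    using that by simp
  ultimately show ?thesis
    unfolding norm_sin_squared by metis
qed

text \<open>
  By the residue theorem for \<open>F z * \<pi>\<^sup>2 / sin\<^sup>2 (\<pi> z)\<close> on the rectangle around \<open>n\<close> with
  vertical sides \<open>Re z = n \<plusminus> 1/2\<close>.  The pole is double; since
  \<open>F z * \<pi> cot (\<pi> z)\<close> is single-valued on the rectangle, its derivative integrates to 0 and
  the integrand may be exchanged for \<open>F' z * \<pi> cot (\<pi> z)\<close>, whose pole is simple with residue
  \<open>F' n\<close>.
\<close>
lemma vertical_mean_step:
  assumes tame: "tame F" and n: "n \<ge> (1::nat)"
  shows "vertical_mean F (real n + 1/2) - vertical_mean F (real n - 1/2) = deriv F (of_nat n)"
proof -
  define c d where "c = real n - 1/2" and "d = real n + 1/2"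
  define k where "k = (\<lambda>z. F z * (of_real pi)\<^sup>2 / (sin (of_real pi * z))\<^sup>2)"
  define h where "h = (\<lambda>z. deriv F z * (of_real pi * cos (of_real pi * z) / sin (of_real pi * z)))"
  define S where "S = {z. real n - 1 < Re z} \<inter> {z. Re z < real n + 1}"
  have S: "open S" "convex S" "connected S"
    unfolding S_def by (intro open_Int open_halfspace_Re_gt open_halfspace_Re_lt
        convex_Int convex_halfspace_Re_gt convex_halfspace_Re_lt convex_connected)+
  have holF: "F holomorphic_on S"
    using tame n by (auto simp: tame_def S_def intro: holomorphic_on_subset)
  have sin0: "sin (of_real pi * z) \<noteq> 0" if "z \<in> S - {of_nat n}" for z
  proof -
    have "\<bar>Re z - real n\<bar> < 1" using that unfolding S_def by (simp add: abs_less_iff)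
    then show ?thesis using sin_pi_eq_0_strip[of z n] that by auto
  qed
  have holk: "k holomorphic_on S - {of_nat n}" and holh: "h holomorphic_on S - {of_nat n}"
    unfolding k_def h_def using sin0 S(1)
    by (auto intro!: holomorphic_intros holomorphic_deriv holomorphic_on_subset[OF holF]
        intro: holomorphic_on_subset[OF holomorphic_deriv[OF holF]])
  have res: "residue h (of_nat n) = deriv F (of_nat n)"
  proof (rule residue_simple'[OF S(1) _ holh])
    have cosn: "cos (of_real pi * of_nat n :: complex) \<noteq> 0"
      using sin_cos_squared_add[of "of_real pi * of_nat n :: complex"]
      by (metis cos_npi2 cos_of_real of_real_eq_0_iff of_real_mult of_real_of_nat_eq power_eq_0_iff zero_neq_neg_one zero_neq_one)
    have "((\<lambda>z. sin (of_real pi * z)) has_field_derivative of_real pi * cos (of_real pi * of_nat n)) (at (of_nat n :: complex))"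
      by (auto intro!: derivative_eq_intros)
    then have "((\<lambda>z. (sin (of_real pi * z) - sin (of_real pi * of_nat n)) / (z - of_nat n))
                \<longlongrightarrow> of_real pi * cos (of_real pi * of_nat n)) (at (of_nat n :: complex))"
      by (simp add: has_field_derivative_iff)
    moreover have "sin (of_real pi * of_nat n :: complex) = 0"
      by (metis of_real_0 of_real_mult of_real_of_nat_eq sin_npi2 sin_of_real)
    ultimately have lim: "((\<lambda>z. sin (of_real pi * z) / (z - of_nat n))
                \<longlongrightarrow> of_real pi * cos (of_real pi * of_nat n)) (at (of_nat n :: complex))"
      by simp
    have nS: "of_nat n \<in> S" by (simp add: S_def)
    have dF: "(deriv F \<longlongrightarrow> deriv F (of_nat n)) (at (of_nat n))"
      using holomorphic_deriv[OF holF S(1)] S(1) nS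
      by (metis continuous_on_eq_continuous_at holomorphic_on_imp_continuous_on isCont_def)
    have "((\<lambda>z. deriv F z * (of_real pi * cos (of_real pi * z)) / (sin (of_real pi * z) / (z - of_nat n)))
       \<longlongrightarrow> deriv F (of_nat n) * (of_real pi * cos (of_real pi * of_nat n)) / (of_real pi * cos (of_real pi * of_nat n)))
       (at (of_nat n))"
      using cosn by (intro tendsto_intros lim dF) auto
    then show "((\<lambda>z. h z * (z - of_nat n)) \<longlongrightarrow> deriv F (of_nat n)) (at (of_nat n))"
      using cosn by (simp add: h_def)
  qed (simp add: S_def)
  have contour: "(k has_contour_integral 2 * of_real pi * \<i> * deriv F (of_nat n))
                   (rectpath (Complex c (- Y)) (Complex d Y))" if Y: "Y > 0" for Y
  proof -
    let ?g = "rectpath (Complex c (- Y)) (Complex d Y)"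
    have img: "path_image ?g \<subseteq> S - {of_nat n}" 
      using Y by (auto simp: path_image_rectpath S_def c_def d_def)
    have "contour_integral ?g h = 2 * pi * \<i> * (\<Sum>p\<in>{of_nat n}. winding_number ?g p * residue h p)"
    proof (rule Residue_theorem[OF S(1,3)])
      show "\<forall>z. z \<notin> S \<longrightarrow> winding_number ?g z = 0"
        using img by (intro allI impI winding_number_zero_outside[OF _ S(2)]) auto
    qed (use holh img in auto)
    moreover have "winding_number ?g (of_nat n) = 1"
      using Y by (intro winding_number_rectpath) (simp add: in_box_complex_iff c_def d_def)
    moreover have "h contour_integrable_on ?g"
      using holh img S(1) by (intro contour_integrable_holomorphic_simple[of _ "S - {of_nat n}"]) auto
    ultimately have "(h has_contour_integral 2 * of_real pi * \<i> * deriv F (of_nat n)) ?g"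
      using has_contour_integral_integral[of h ?g] by (simp add: res)
    moreover have "((\<lambda>z. h z - k z) has_contour_integral 0) ?g"
    proof (rule Cauchy_theorem_primitive[where S = "S - {of_nat n}" and f = "\<lambda>z. F z * (of_real pi * cos (of_real pi * z) / sin (of_real pi * z))"])
      fix z assume z: "z \<in> S - {of_nat n}"
      note nz = sin0[OF z]
      have dF: "(F has_field_derivative deriv F z) (at z)"
        using z holF S(1) by (intro holomorphic_derivI[of _ S]) auto
      have sq: "cos (z * of_real pi) * cos (z * of_real pi) = 1 - sin (z * of_real pi) * sin (z * of_real pi)"
        using sin_cos_squared_add[of "z * of_real pi"] by (simp add: power2_eq_square algebra_simps)
      have "((\<lambda>z. F z * (of_real pi * cos (of_real pi * z) / sin (of_real pi * z))) has_field_derivative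
              h z - k z) (at z)"
        by (rule derivative_eq_intros dF refl | use nz in \<open>simp; fail\<close>)+
           (use nz in \<open>simp add: h_def k_def divide_simps power2_eq_square, simp add: algebra_simps sq\<close>)
      then show "((\<lambda>z. F z * (of_real pi * cos (of_real pi * z) / sin (of_real pi * z))) has_field_derivative
              h z - k z) (at z within S - {of_nat n})"
        by (rule has_field_derivative_at_within)
    qed (use img in auto)
    ultimately have "((\<lambda>z. h z - (h z - k z)) has_contour_integral 2 * of_real pi * \<i> * deriv F (of_nat n) - 0) ?g"
      by (rule has_contour_integral_diff)
    then show ?thesis by simp
  qed
  obtain K where K: "K \<ge> 0" "\<And>x y. x \<ge> 1/2 \<Longrightarrow> norm (F (Complex x y)) \<le> K * exp x * exp (2 * \<bar>y\<bar>)"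
    using tame_bound[OF tame] by metis
  define B where "B = (\<lambda>N. 8 * pi\<^sup>2 * K * exp d * exp (- 4 * real N))"
  define I where "I = (\<lambda>x N. integral {- real N..real N} (\<lambda>y. F (Complex x y) * of_real (pi / 2 / (cosh (pi * y))\<^sup>2)))"
  have edge: "norm (k (Complex x y)) \<le> B N"
    if "x \<in> {c..d}" "\<bar>y\<bar> = real N" "N \<ge> 1" for x y N
  proof -
    have s: "exp (6 * real N) / 8 \<le> norm (sin (of_real pi * Complex x y)) ^ 2"
      using that by (intro norm_sin_squared_ge) auto
    have "norm (F (Complex x y)) \<le> K * exp x * exp (2 * \<bar>y\<bar>)"
      using that n by (intro K) (simp add: c_def)
    also have "\<dots> \<le> K * exp d * exp (2 * real N)"
      using that K(1) by (auto intro!: mult_right_mono mult_left_mono)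
    finally have "norm (k (Complex x y)) \<le> (K * exp d * exp (2 * real N)) * pi\<^sup>2 / (exp (6 * real N) / 8)"
      unfolding k_def norm_divide norm_mult norm_power using s
      by (intro frac_le mult_mono) (auto intro!: mult_nonneg_nonneg K(1))
    also have "exp (6 * real N) = exp (2 * real N) * exp (4 * real N)"
      by (simp flip: exp_add)
    finally show ?thesis by (simp add: B_def exp_minus field_simps)
  qed
  have step: "norm ((I d N - I c N) - deriv F (of_nat n)) \<le> B N" if N: "N \<ge> 1" for N
  proof -
    let ?Y = "real N"
    define a1 a2 a3 a4 where "a1 = Complex c (- ?Y)" and "a2 = Complex d (- ?Y)"
      and "a3 = Complex d ?Y" and "a4 = Complex c ?Y"
    have ok: "k contour_integrable_on linepath a b"
      if "closed_segment a b \<subseteq> path_image (rectpath a1 a3)" for a b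
    proof (intro contour_integrable_holomorphic_simple[of k "S - {of_nat n}"] holk)
      have "path_image (rectpath a1 a3) \<subseteq> S - {of_nat n}"
        using N by (auto simp: path_image_rectpath S_def c_def d_def a1_def a3_def)
      then show "path_image (linepath a b) \<subseteq> S - {of_nat n}" using that by auto
    qed (use S(1) in auto)
    have img: "path_image (rectpath a1 a3) = closed_segment a1 a2 \<union> (closed_segment a2 a3 \<union> (closed_segment a3 a4 \<union> closed_segment a4 a1))"
      by (simp add: rectpath_def Let_def path_image_join a1_def a2_def a3_def a4_def)
    have ints: "k contour_integrable_on linepath a1 a2" "k contour_integrable_on linepath a2 a3"
      "k contour_integrable_on linepath a3 a4" "k contour_integrable_on linepath a4 a1"
      by (rule ok; auto simp: img)+
    have "2 * of_real pi * \<i> * deriv F (of_nat n) = contour_integral (rectpath a1 a3) k"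
      using contour[of ?Y] N by (simp add: a1_def a3_def contour_integral_unique)
    also have "\<dots> = contour_integral (linepath a1 a2) k + (contour_integral (linepath a2 a3) k
        + (contour_integral (linepath a3 a4) k + contour_integral (linepath a4 a1) k))"
    proof -
      have "rectpath a1 a3 = linepath a1 a2 +++ linepath a2 a3 +++ linepath a3 a4 +++ linepath a4 a1"
        by (simp add: rectpath_def Let_def a1_def a2_def a3_def a4_def)
      then show ?thesis using ints by (simp add: contour_integrable_joinI)
    qed
    also have "contour_integral (linepath a4 a1) k = - contour_integral (linepath a1 a4) k"
      by (metis contour_integral_reverse_linepath ints(4) contour_integral_reversepath reversepath_linepath valid_path_linepath)
    also have "contour_integral (linepath a1 a4) k = 2 * of_real pi * \<i> * I c N"
    proof -
      have "k (Complex c y) = 2 * of_real pi * (F (Complex c y) * of_real (pi / 2 / (cosh (pi * y))\<^sup>2))" for y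
        using sin_squared_half_line[of c "n - 1" y] n
        by (simp add: k_def c_def of_nat_diff power2_eq_square)
      then have "(\<lambda>y. k (Complex c y)) = (\<lambda>y. 2 * of_real pi * (F (Complex c y) * of_real (pi / 2 / (cosh (pi * y))\<^sup>2)))" ..
      moreover have "contour_integral (linepath a1 a4) k = \<i> * integral {- ?Y..?Y} (\<lambda>y. k (Complex c y))"
        using N by (intro contour_integral_linepath_same_Re) (auto simp: a1_def a4_def)
      ultimately show ?thesis
        by (simp only: I_def integral_mult_right mult_ac)
    qed
    also have "contour_integral (linepath a2 a3) k = 2 * of_real pi * \<i> * I d N"
    proof -
      have "k (Complex d y) = 2 * of_real pi * (F (Complex d y) * of_real (pi / 2 / (cosh (pi * y))\<^sup>2))" for y
        using sin_squared_half_line[of d n y]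
        by (simp add: k_def d_def power2_eq_square)
      then have "(\<lambda>y. k (Complex d y)) = (\<lambda>y. 2 * of_real pi * (F (Complex d y) * of_real (pi / 2 / (cosh (pi * y))\<^sup>2)))" ..
      moreover have "contour_integral (linepath a2 a3) k = \<i> * integral {- ?Y..?Y} (\<lambda>y. k (Complex d y))"
        using N by (intro contour_integral_linepath_same_Re) (auto simp: a2_def a3_def)
      ultimately show ?thesis
        by (simp only: I_def integral_mult_right mult_ac)
    qed
    finally have "2 * of_real pi * \<i> * ((I d N - I c N) - deriv F (of_nat n))
        = - contour_integral (linepath a1 a2) k - contour_integral (linepath a3 a4) k"
      by (simp add: algebra_simps)
    then have "2 * pi * norm ((I d N - I c N) - deriv F (of_nat n))
        = norm (- contour_integral (linepath a1 a2) k - contour_integral (linepath a3 a4) k)"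
      by (metis (no_types, lifting) abs_of_pos mult.right_neutral norm_ii norm_mult norm_numeral norm_of_real pi_gt_zero)
    also have "\<dots> \<le> norm (contour_integral (linepath a1 a2) k) + norm (contour_integral (linepath a3 a4) k)"
      by (metis norm_minus_cancel norm_triangle_ineq4)
    also have "\<dots> \<le> B N * norm (a2 - a1) + B N * norm (a4 - a3)"
    proof (intro add_mono contour_integral_bound_linepath ints)
      show "B N \<ge> 0" "B N \<ge> 0" using K(1) by (simp_all add: B_def)
      show "norm (k z) \<le> B N" if "z \<in> closed_segment a1 a2" for z
        using edge[of "Re z" "Im z" N] that N
        by (auto simp: a1_def a2_def closed_segment_same_Im closed_segment_eq_real_ivl c_def d_def split: if_splits)
      show "norm (k z) \<le> B N" if "z \<in> closed_segment a3 a4" for z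
        using edge[of "Re z" "Im z" N] that N
        by (auto simp: a3_def a4_def closed_segment_same_Im closed_segment_eq_real_ivl c_def d_def split: if_splits)
    qed
    also have "norm (a2 - a1) = 1" 
      by (simp add: a1_def a2_def c_def d_def cmod_def)
    also have "norm (a4 - a3) = 1" 
      by (simp add: a3_def a4_def c_def d_def cmod_def)
    also have "B N * 1 + B N * 1 \<le> 2 * pi * B N"
    proof -
      have "B N \<ge> 0" using K(1) by (simp add: B_def)
      then show ?thesis using pi_gt3 mult_right_mono[of 1 pi "B N"] by simp
    qed
    finally show ?thesis by simp
  qed
  have "(\<lambda>N. (I d N - I c N) - deriv F (of_nat n)) \<longlonglongrightarrow> (vertical_mean F d - vertical_mean F c) - deriv F (of_nat n)"
    unfolding I_def using n
    by (intro tendsto_intros vertical_segment_tendsto tame) (auto simp: c_def d_def)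
  moreover have "(\<lambda>N. (I d N - I c N) - deriv F (of_nat n)) \<longlonglongrightarrow> 0"
  proof (rule Lim_null_comparison)
    show "\<forall>\<^sub>F N in sequentially. norm ((I d N - I c N) - deriv F (of_nat n)) \<le> B N"
      using step by (auto intro: eventually_sequentiallyI[of 1])
    show "B \<longlonglongrightarrow> 0" unfolding B_def by real_asymp
  qed
  ultimately have "(vertical_mean F d - vertical_mean F c) - deriv F (of_nat n) = 0"
    by (rule LIMSEQ_unique)
  then show ?thesis by (simp add: c_def d_def)
qed

lemma tameI:
  assumes "\<And>z. Re z > 0 \<Longrightarrow> (F has_field_derivative f z) (at z)"
    and "\<And>z. Re z \<ge> 1/2 \<Longrightarrow> norm (F z) \<le> K * exp (norm z)"
  shows "tame F"
  unfolding tame_def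
proof
  show "F holomorphic_on {z. Re z > 0}"
    using assms(1) by (subst holomorphic_on_open) (auto simp: open_halfspace_Re_gt)
  show "\<exists>K. \<forall>z. Re z \<ge> 1/2 \<longrightarrow> norm (F z) \<le> K * exp (norm z)"
    using assms(2) by (intro exI[of _ K] allI impI)
qed

text \<open>
  The kernel is concentrated near \<open>y = 0\<close>, so the mean is close to the central value as soon
  as the derivative of \<open>F\<close> is small on the line.
\<close>
lemma vertical_mean_minus_value:
  assumes tame: "tame F" and x: "x \<ge> 1/2"
    and df: "\<And>z. Re z > 0 \<Longrightarrow> (F has_field_derivative f z) (at z)"
    and bd: "\<And>z. Re z = x \<Longrightarrow> norm (f z) \<le> e * exp \<bar>Im z\<bar>"
  shows "norm (vertical_mean F x - F (of_real x)) \<le> e * (LINT y|sech_measure. exp (2 * \<bar>y\<bar>))"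
proof -
  have "0 \<le> e * exp \<bar>Im (of_real x)\<bar>"
    by (rule order_trans[OF norm_ge_zero bd]) simp
  then have e: "e \<ge> 0" by simp
  have pt: "norm (F (Complex x y) - F (of_real x)) \<le> e * exp (2 * \<bar>y\<bar>)" for y
  proof -
    have "norm (F (Complex x y) - F (of_real x)) \<le> (e * exp \<bar>y\<bar>) * norm (Complex x y - of_real x)"
    proof (rule field_differentiable_bound[of "closed_segment (of_real x) (Complex x y)" F f])
      fix z assume z: "z \<in> closed_segment (of_real x) (Complex x y)"
      then obtain u where u: "0 \<le> u" "u \<le> 1" "z = (1 - u) *\<^sub>R of_real x + u *\<^sub>R Complex x y"
        unfolding in_segment by metis
      have z': "Re z = x" "Im z = u * y"
        unfolding u(3) by (simp_all add: algebra_simps)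
      have "\<bar>Im z\<bar> \<le> 1 * \<bar>y\<bar>"
        unfolding z'(2) abs_mult using u(1,2) by (intro mult_right_mono) auto
      from z'(1) have "Re z > 0" using x by simp
      then show "(F has_field_derivative f z) (at z within closed_segment (of_real x) (Complex x y))"
        by (rule has_field_derivative_at_within[OF df])
      have "norm (f z) \<le> e * exp \<bar>Im z\<bar>" by (rule bd[OF z'(1)])
      also have "\<dots> \<le> e * exp \<bar>y\<bar>" using \<open>\<bar>Im z\<bar> \<le> 1 * \<bar>y\<bar>\<close> e by (intro mult_left_mono) auto
      finally show "norm (f z) \<le> e * exp \<bar>y\<bar>" .
    qed simp_all
    also have "Complex x y - of_real x = \<i> * of_real y" by (simp add: complex_eq_iff)
    also have "e * exp \<bar>y\<bar> * norm (\<i> * of_real y :: complex) \<le> e * exp \<bar>y\<bar> * exp \<bar>y\<bar>"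
    proof -
      have "\<bar>y\<bar> \<le> exp \<bar>y\<bar>" using exp_ge_add_one_self[of "\<bar>y\<bar>"] by linarith
      then show ?thesis using e by (intro mult_left_mono) (auto simp: norm_mult)
    qed
    also have "\<dots> = e * exp (2 * \<bar>y\<bar>)"
      by (simp add: mult.assoc exp_double power2_eq_square)
    finally show ?thesis .
  qed
  have int: "integrable sech_measure (\<lambda>y. F (Complex x y))"
    by (rule tame_integrable[OF tame x])
  have int_diff: "integrable sech_measure (\<lambda>y. F (Complex x y) - F (of_real x))"
    using int sech_measure_const(1) by (rule Bochner_Integration.integrable_diff)
  have "vertical_mean F x - F (of_real x) = (LINT y|sech_measure. F (Complex x y) - F (of_real x))"
    using Bochner_Integration.integral_diff[OF int sech_measure_const(1)[of "F (of_real x)"]]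
      sech_measure_const(2)[of "F (of_real x)"] unfolding vertical_mean_def by argo
  also have "norm \<dots> \<le> (LINT y|sech_measure. norm (F (Complex x y) - F (of_real x)))"
    by (rule integral_norm_bound)
  also have "\<dots> \<le> (LINT y|sech_measure. e * exp (2 * \<bar>y\<bar>))"
    by (rule integral_mono[OF integrable_norm[OF int_diff]
          integrable_mult_right[OF integrable_sech_measure_exp] pt])
  finally show ?thesis by simp
qed

text \<open>
  An Euler-Maclaurin formula whose remainder is completely explicit: the regularised sum of
  \<open>f\<close> is a linear functional of an antiderivative on the single line \<open>Re z = 1/2\<close>.  It is used
  three times, for \<open>z powr (- s)\<close>, for \<open>1 / z\<close> and for the summand of the theorem.
\<close>
theorem sum_minus_antiderivative_tendsto:
  assumes df: "\<And>z. Re z > 0 \<Longrightarrow> (F has_field_derivative f z) (at z)"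
    and growth: "\<And>z. Re z \<ge> 1/2 \<Longrightarrow> norm (F z) \<le> K * exp (norm z)"
    and bd: "\<forall>\<^sub>F N in sequentially. \<forall>z. Re z = real N + 1/2 \<longrightarrow> norm (f z) \<le> e N * exp \<bar>Im z\<bar>"
    and e: "e \<longlonglongrightarrow> 0"
  shows "(\<lambda>N. (\<Sum>n<N. f (of_nat (Suc n))) - F (of_real (real N + 1/2))) \<longlonglongrightarrow> - vertical_mean F (1/2)"
proof -
  have tame: "tame F" using df growth by (rule tameI)
  have sum: "(\<Sum>n<N. f (of_nat (Suc n))) = vertical_mean F (real N + 1/2) - vertical_mean F (1/2)" for N
  proof (induction N)
    case (Suc N)
    have "deriv F (of_nat (Suc N)) = f (of_nat (Suc N))"
      by (intro DERIV_imp_deriv df) simp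
    then have "f (of_nat (Suc N)) = vertical_mean F (real (Suc N) + 1/2) - vertical_mean F (real N + 1/2)"
      using vertical_mean_step[OF tame, of "Suc N"] by (simp add: algebra_simps)
    with Suc show ?case by (simp del: of_nat_Suc)
  qed simp
  define I where "I = (LINT y|sech_measure. exp (2 * \<bar>y\<bar>))"
  have "(\<lambda>N. vertical_mean F (real N + 1/2) - F (of_real (real N + 1/2))) \<longlonglongrightarrow> 0"
  proof (rule Lim_null_comparison)
    show "\<forall>\<^sub>F N in sequentially. norm (vertical_mean F (real N + 1/2) - F (of_real (real N + 1/2))) \<le> e N * I"
      using bd unfolding I_def by eventually_elim (intro vertical_mean_minus_value[OF tame _ df], auto)
    show "(\<lambda>N. e N * I) \<longlonglongrightarrow> 0" using tendsto_mult_right[OF e, of I] by simp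
  qed
  from tendsto_diff[OF this tendsto_const[of "vertical_mean F (1/2)"]] show ?thesis
    unfolding sum by (simp add: algebra_simps)
qed

lemma abs_Im_Ln_le_pi: "z \<noteq> 0 \<Longrightarrow> \<bar>Im (Ln z)\<bar> \<le> pi"
  using mpi_less_Im_Ln[of z] Im_Ln_le_pi[of z] by linarith

text \<open>
  The factor 1/2 leaves room to add a second contribution of size \<open>norm z / 2\<close> in an
  exponent.
\<close>
lemma Ln_growth:
  assumes c: "c \<ge> 0"
  obtains K where "\<And>z. Re z \<ge> 1/2 \<Longrightarrow> c * norm (Ln z) \<le> norm z / 2 + K"
proof
  define K where "K = c * (2 * ln 2 + pi + (ln (2 * (c + 1)) - 1))"
  fix z :: complex assume z: "Re z \<ge> 1/2"
  define r where "r = norm z"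
  have r: "r \<ge> 1/2" using z complex_Re_le_cmod[of z] by (simp add: r_def)
  have z0: "z \<noteq> 0" using z by auto
  have "\<bar>ln r\<bar> \<le> ln r + 2 * ln 2"
  proof (cases "r \<ge> 1")
    case False
    have "ln (1/2) \<le> ln r" using r by (subst ln_le_cancel_iff) auto
    then show ?thesis using False r by (simp add: ln_div)
  qed (use ln_ge_zero[of r] in auto)
  moreover have "norm (Ln z) \<le> \<bar>ln r\<bar> + pi"
    using cmod_le[of "Ln z"] z0 abs_Im_Ln_le_pi[OF z0] by (simp add: r_def)
  moreover have "ln r \<le> r / (2 * (c + 1)) - 1 + ln (2 * (c + 1))"
    using ln_le_minus_one[of "r / (2 * (c + 1))"] r c by (simp add: ln_div)
  ultimately have "norm (Ln z) \<le> r / (2 * (c + 1)) + (2 * ln 2 + pi + (ln (2 * (c + 1)) - 1))"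
    by linarith
  then have "c * norm (Ln z) \<le> c * (r / (2 * (c + 1))) + K"
    unfolding K_def distrib_left[symmetric] using c by (intro mult_left_mono) auto
  also have "c * (r / (2 * (c + 1))) \<le> r / 2"
    using c r by (simp add: field_simps)
  finally show "c * norm (Ln z) \<le> norm z / 2 + K" by (simp add: r_def)
qed

lemma norm_powr_le_exp: "z \<noteq> 0 \<Longrightarrow> norm (z powr s) \<le> exp (norm s * norm (Ln z))"
proof -
  assume "z \<noteq> 0"
  then have "norm (z powr s) = exp (Re (s * Ln z))" by (simp add: powr_def)
  also have "\<dots> \<le> exp (norm (s * Ln z))" using complex_Re_le_cmod exp_le_cancel_iff by blast
  finally show ?thesis by (simp add: norm_mult)
qed

text \<open>
  Dominated convergence.  All interchanges of summation with the vertical mean rest on this,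
  including the convergence of the series of zeta values in the theorem.
\<close>
lemma vertical_mean_sums:
  fixes g :: "nat \<Rightarrow> complex \<Rightarrow> complex"
  assumes x: "x > 0"
    and cont: "\<And>k. continuous_on {z. Re z > 0} (g k)"
    and sums_z: "\<And>z. Re z = x \<Longrightarrow> (\<lambda>k. g k z) sums G z"
    and bd_z: "\<And>n z. Re z = x \<Longrightarrow> (\<Sum>k<n. norm (g k z)) \<le> K * exp (2 * \<bar>Im z\<bar>)"
  shows "(\<lambda>k. vertical_mean (g k) x) sums vertical_mean G x"
proof -
  have sums: "(\<lambda>k. g k (Complex x y)) sums G (Complex x y)"
    and bd: "(\<Sum>k<n. norm (g k (Complex x y))) \<le> K * exp (2 * \<bar>y\<bar>)" for n y
    using sums_z[of "Complex x y"] bd_z[of "Complex x y" n] by simp_all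
  have meas: "(\<lambda>y. g k (Complex x y)) \<in> borel_measurable sech_measure" for k
    using measurable_vertical[OF cont x, of k] by (simp cong: measurable_cong_sets)
  have int: "integrable sech_measure (\<lambda>y. g k (Complex x y))" for k
  proof (intro integrable_vertical[OF cont x])
    show "norm (g k (Complex x y)) \<le> K * exp (2 * \<bar>y\<bar>)" for y :: real
      using member_le_sum[of k "{..<Suc k}" "\<lambda>k. norm (g k (Complex x y))"] bd[where n = "Suc k" and y = y] by auto
  qed
  have "(\<lambda>n. LINT y|sech_measure. (\<Sum>k<n. g k (Complex x y))) \<longlonglongrightarrow> vertical_mean G x"
    unfolding vertical_mean_def
  proof (rule integral_dominated_convergence)
    show "integrable sech_measure (\<lambda>y. K * exp (2 * \<bar>y\<bar>))"
      by (intro integrable_mult_right integrable_sech_measure_exp)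
    show ms: "(\<lambda>y. \<Sum>k<n. g k (Complex x y)) \<in> borel_measurable sech_measure" for n
      using meas by (intro borel_measurable_sum)
    show "AE y in sech_measure. (\<lambda>n. \<Sum>k<n. g k (Complex x y)) \<longlonglongrightarrow> G (Complex x y)"
      using sums unfolding sums_def by (intro AE_I2)
    show "(\<lambda>y. G (Complex x y)) \<in> borel_measurable sech_measure"
      using sums unfolding sums_def by (intro borel_measurable_LIMSEQ_metric[OF ms])
    show "AE y in sech_measure. norm (\<Sum>k<n. g k (Complex x y)) \<le> K * exp (2 * \<bar>y\<bar>)" for n
      by (intro AE_I2 order_trans[OF norm_sum bd])
  qed
  moreover have "(LINT y|sech_measure. (\<Sum>k<n. g k (Complex x y))) = (\<Sum>k<n. vertical_mean (g k) x)" for n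
    unfolding vertical_mean_def using int by (intro Bochner_Integration.integral_sum)
  ultimately show ?thesis by (simp add: sums_def)
qed

section \<open>The zeta function as a vertical mean\<close>
lemma exp_partial_sum_le:
  fixes x :: real
  assumes "x \<ge> 0"
  shows "(\<Sum>k<n. x ^ k / fact k) \<le> exp x"
proof -
  have "(\<lambda>k. x ^ k / fact k) sums exp x"
    using exp_converges[of x] by (simp add: divide_inverse_commute)
  then show ?thesis
    using sum_le_suminf[of "\<lambda>k. x ^ k / fact k" "{..<n}"] assms by (simp add: sums_iff)
qed

text \<open>
  Expanding \<open>exp (s * Ln z)\<close> under the mean exhibits the function as an everywhere
  convergent power series in \<open>s\<close>, which avoids differentiating under the integral sign.
\<close>
lemma vertical_mean_powr_entire: "(\<lambda>s. vertical_mean (\<lambda>z. z powr s) (1/2)) holomorphic_on A"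
proof -
  define c where "c = (\<lambda>k. vertical_mean (\<lambda>z. Ln z ^ k / fact k) (1/2))"
  have sums: "(\<lambda>k. c k * s ^ k) sums vertical_mean (\<lambda>z. z powr s) (1/2)" for s
  proof -
    obtain K where K: "\<And>z. Re z \<ge> 1/2 \<Longrightarrow> norm s * norm (Ln z) \<le> norm z / 2 + K"
      by (rule Ln_growth[OF norm_ge_zero[of s]]) (rule that)
    have "(\<lambda>k. vertical_mean (\<lambda>z. Ln z ^ k / fact k * s ^ k) (1/2)) sums vertical_mean (\<lambda>z. z powr s) (1/2)"
    proof (rule vertical_mean_sums)
      show "continuous_on {z. Re z > 0} (\<lambda>z. Ln z ^ k / fact k * s ^ k)" for k
        by (intro continuous_intros) (auto simp: complex_nonpos_Reals_iff)
      fix z :: complex assume z: "Re z = 1/2"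
      have z0: "z \<noteq> 0" using z by auto
      have "(\<lambda>k. (s * Ln z) ^ k /\<^sub>R fact k) sums exp (s * Ln z)"
        by (rule exp_converges)
      moreover have "(s * Ln z) ^ k /\<^sub>R fact k = Ln z ^ k / fact k * s ^ k" for k
        unfolding power_mult_distrib scaleR_conv_of_real by (simp add: divide_inverse)
      ultimately show "(\<lambda>k. Ln z ^ k / fact k * s ^ k) sums (z powr s)"
        using z0 by (simp add: powr_def)
      fix n
      have "(\<Sum>k<n. (norm s * norm (Ln z)) ^ k / fact k) \<le> exp (norm s * norm (Ln z))"
        by (intro exp_partial_sum_le mult_nonneg_nonneg norm_ge_zero)
      also have "norm s * norm (Ln z) \<le> K + 1 + 2 * \<bar>Im z\<bar>"
        using K[of z] cmod_le[of z] z by simp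
      then have "exp (norm s * norm (Ln z)) \<le> exp (K + 1) * exp (2 * \<bar>Im z\<bar>)"
        by (simp flip: exp_add)
      finally have "(\<Sum>k<n. (norm s * norm (Ln z)) ^ k / fact k) \<le> exp (K + 1) * exp (2 * \<bar>Im z\<bar>)" .
      moreover have "norm (Ln z ^ k / fact k * s ^ k) = (norm s * norm (Ln z)) ^ k / fact k" for k
        unfolding norm_mult norm_divide norm_power power_mult_distrib norm_fact by simp
      ultimately show "(\<Sum>k<n. norm (Ln z ^ k / fact k * s ^ k)) \<le> exp (K + 1) * exp (2 * \<bar>Im z\<bar>)"
        by (simp only:)
    qed simp
    then show ?thesis by (simp add: c_def vertical_mean_def)
  qed
  have "((\<lambda>s. \<Sum>k. c k * s ^ k) has_field_derivative (\<Sum>k. diffs c k * s ^ k)) (at s)" for s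
    using sums by (intro termdiffs_strong_converges_everywhere) (auto simp: sums_iff)
  then have "(\<lambda>s. \<Sum>k. c k * s ^ k) holomorphic_on UNIV"
    by (subst holomorphic_on_open) auto
  then have "(\<lambda>s. \<Sum>k. c k * s ^ k) holomorphic_on A"
    by (rule holomorphic_on_subset) simp
  also have "(\<lambda>s. \<Sum>k. c k * s ^ k) = (\<lambda>s. vertical_mean (\<lambda>z. z powr s) (1/2))"
    using sums by (simp add: sums_iff)
  finally show ?thesis .
qed

lemma Dirichlet_series_eq_vertical_mean:
  assumes s: "Re s > 1"
  shows "(\<lambda>n. 1 / of_nat (Suc n) powr s) sums (vertical_mean (\<lambda>z. z powr (1 - s)) (1/2) / (s - 1))"
proof -
  define F where "F = (\<lambda>z. z powr (1 - s) / (1 - s))"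
  have s1: "s \<noteq> 1" using s by auto
  obtain K where K: "\<And>z. Re z \<ge> 1/2 \<Longrightarrow> norm (1 - s) * norm (Ln z) \<le> norm z / 2 + K"
    by (rule Ln_growth[OF norm_ge_zero[of "1 - s"]]) (rule that)
  have "(\<lambda>N. (\<Sum>n<N. of_nat (Suc n) powr (- s)) - F (of_real (real N + 1/2))) \<longlonglongrightarrow> - vertical_mean F (1/2)"
  proof (rule sum_minus_antiderivative_tendsto)
    show "(F has_field_derivative z powr (- s)) (at z)" if "Re z > 0" for z
    proof -
      have "((\<lambda>z. z powr (1 - s)) has_field_derivative (1 - s) * z powr (1 - s - 1)) (at z)"
        using that by (intro has_field_derivative_powr) (auto simp: complex_nonpos_Reals_iff)
      from DERIV_cdivide[OF this, of "1 - s"] show ?thesis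
        using s1 by (simp add: F_def)
    qed
    show "norm (F z) \<le> exp K / norm (1 - s) * exp (norm z)" if "Re z \<ge> 1/2" for z
    proof -
      have "norm (z powr (1 - s)) \<le> exp (norm (1 - s) * norm (Ln z))"
        using that by (intro norm_powr_le_exp) auto
      also have "\<dots> \<le> exp (K + norm z)"
        using K[OF that] norm_ge_zero[of z] by (subst exp_le_cancel_iff) linarith
      finally show ?thesis by (simp add: F_def norm_divide divide_right_mono exp_add)
    qed
    have "norm (z powr - s) \<le> (real N + 1/2) powr (- Re s) * exp (\<bar>Im s\<bar> * pi) * exp \<bar>Im z\<bar>"
      if z: "Re z = real N + 1/2" for N z
    proof -
      have z0: "z \<noteq> 0" using z by auto
      have "norm (z powr - s) = exp (- (Re s * ln (norm z)) + Im s * Im (Ln z))"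
        using z0 by (simp add: powr_def)
      moreover have "Re s * ln (real N + 1/2) \<le> Re s * ln (norm z)"
        using complex_Re_le_cmod[of z] s z by (intro mult_left_mono ln_mono) auto
      moreover have "Im s * Im (Ln z) \<le> \<bar>Im s\<bar> * pi"
      proof -
        have "Im s * Im (Ln z) \<le> \<bar>Im s\<bar> * \<bar>Im (Ln z)\<bar>"
          by (metis abs_ge_self abs_mult)
        also have "\<dots> \<le> \<bar>Im s\<bar> * pi"
          using abs_Im_Ln_le_pi[OF z0] by (intro mult_left_mono) auto
        finally show ?thesis .
      qed
      ultimately have "norm (z powr - s) \<le> exp (- (Re s * ln (real N + 1/2)) + \<bar>Im s\<bar> * pi)"
        by simp
      also have "\<dots> = (real N + 1/2) powr (- Re s) * exp (\<bar>Im s\<bar> * pi) * 1"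
        by (simp add: powr_def flip: exp_add)
      also have "\<dots> \<le> (real N + 1/2) powr (- Re s) * exp (\<bar>Im s\<bar> * pi) * exp \<bar>Im z\<bar>"
        by (intro mult_left_mono) auto
      finally show ?thesis .
    qed
    then show "\<forall>\<^sub>F N in sequentially. \<forall>z. Re z = real N + 1/2 \<longrightarrow> norm (z powr - s)
        \<le> (real N + 1/2) powr (- Re s) * exp (\<bar>Im s\<bar> * pi) * exp \<bar>Im z\<bar>"
      by simp
    have "(\<lambda>N. (real N + 1/2) powr (- Re s)) \<longlonglongrightarrow> 0"
      using s by real_asymp
    then show "(\<lambda>N. (real N + 1/2) powr (- Re s) * exp (\<bar>Im s\<bar> * pi)) \<longlonglongrightarrow> 0"
      by (rule tendsto_mult_left_zero)
  qed
  moreover have "(\<lambda>N. F (of_real (real N + 1/2))) \<longlonglongrightarrow> 0"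
  proof (rule tendsto_norm_zero_cancel)
    have "norm (F (of_real (real N + 1/2))) = (real N + 1/2) powr (1 - Re s) / norm (1 - s)" for N
      by (simp add: F_def norm_divide norm_powr_real_powr del: of_real_add of_real_divide)
    moreover have "(\<lambda>N. (real N + 1/2) powr (1 - Re s)) \<longlonglongrightarrow> 0"
      using s by real_asymp
    ultimately show "(\<lambda>N. norm (F (of_real (real N + 1/2)))) \<longlonglongrightarrow> 0"
      by (simp add: tendsto_divide_zero)
  qed
  ultimately have "(\<lambda>N. ((\<Sum>n<N. of_nat (Suc n) powr (- s)) - F (of_real (real N + 1/2)))
      + F (of_real (real N + 1/2))) \<longlonglongrightarrow> - vertical_mean F (1/2) + 0"
    by (rule tendsto_add)
  then have "(\<lambda>N. \<Sum>n<N. of_nat (Suc n) powr (- s)) \<longlonglongrightarrow> - vertical_mean F (1/2)"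
    by (simp only: diff_add_cancel add_0_right)
  moreover have "- vertical_mean F (1/2) = vertical_mean (\<lambda>z. z powr (1 - s)) (1/2) / (s - 1)"
    using s1 by (simp add: F_def vertical_mean_def field_simps)
  ultimately show ?thesis
    by (simp add: sums_def powr_minus_divide)
qed

text \<open>
  Jensen's formula.  The right-hand side continues the Dirichlet series to the punctured
  plane, so it is the zeta function by the identity theorem.
\<close>
lemma zeta_eq_vertical_mean:
  assumes "s \<noteq> 1"
  shows "zeta s = vertical_mean (\<lambda>z. z powr (1 - s)) (1/2) / (s - 1)"
proof -
  let ?P = "\<lambda>f. f holomorphic_on - {1} \<and> f 1 = 0 \<and>
             (\<forall>s. Re s > 1 \<longrightarrow> (\<lambda>n. 1 / of_nat (Suc n) powr s) sums f s)"
  define Z where "Z = (\<lambda>s. if s = 1 then 0 else vertical_mean (\<lambda>z. z powr (1 - s)) (1/2) / (s - 1))"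
  have ent: "(\<lambda>s. vertical_mean (\<lambda>z. z powr s) (1/2)) holomorphic_on UNIV"
    by (rule vertical_mean_powr_entire)
  have "((\<lambda>s. vertical_mean (\<lambda>z. z powr s) (1/2)) \<circ> (\<lambda>s. 1 - s)) holomorphic_on - {1}"
    by (rule holomorphic_on_compose_gen[OF _ ent]) (auto intro!: holomorphic_intros)
  then have "(\<lambda>s. vertical_mean (\<lambda>z. z powr (1 - s)) (1/2) / (s - 1)) holomorphic_on - {1}"
    by (intro holomorphic_on_divide holomorphic_intros) (auto simp: o_def)
  then have hol: "Z holomorphic_on - {1}"
    by (rule holomorphic_transform) (simp add: Z_def)
  have Z: "?P Z"
    using hol Dirichlet_series_eq_vertical_mean by (auto simp: Z_def)
  have uniq: "g = Z" if g: "?P g" for g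
  proof
    fix s :: complex
    show "g s = Z s"
    proof (cases "s = 1")
      case False
      have "g s - Z s = 0"
      proof (rule analytic_continuation[of "\<lambda>s. g s - Z s" "- {1}" "{s. Re s > 1}" 2])
        show "(\<lambda>s. g s - Z s) holomorphic_on - {1}"
          using g hol by (intro holomorphic_on_diff) auto
        show "connected (- {1::complex})"
          by (rule connected_punctured_universe) simp
        have "(2::complex) \<in> {s. Re s > 1}" by simp
        then show "(2::complex) islimpt {s. Re s > 1}"
          by (metis interior_limit_point interior_open open_halfspace_Re_gt)
        show "g u - Z u = 0" if "u \<in> {s. Re s > 1}" for u
        proof -
          have "Re u > 1" using that by simp
          then have "(\<lambda>n. 1 / of_nat (Suc n) powr u) sums g u" "(\<lambda>n. 1 / of_nat (Suc n) powr u) sums Z u"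
            using g Z by blast+
          then have "g u = Z u" by (rule sums_unique2)
          then show ?thesis by simp
        qed
      qed (use False in auto)
      then show ?thesis by simp
    qed (use g Z in auto)
  qed
  have "zeta = Z"
    unfolding zeta_def by (rule the_equality[of ?P, OF Z uniq])
  then have "zeta s = Z s" by (rule fun_cong)
  also have "Z s = vertical_mean (\<lambda>z. z powr (1 - s)) (1/2) / (s - 1)"
    using assms by (simp add: Z_def)
  finally show ?thesis .
qed

lemma Ln_bound:
  obtains K where "\<And>z. Re z \<ge> 1/2 \<Longrightarrow> norm (Ln z) \<le> K * exp (norm z)"
proof -
  obtain K where K: "\<And>z. Re z \<ge> 1/2 \<Longrightarrow> 1 * norm (Ln z) \<le> norm z / 2 + K"
    by (rule Ln_growth[OF zero_le_one]) (rule that)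
  have "norm (Ln z) \<le> exp K * exp (norm z)" if "Re z \<ge> 1/2" for z
  proof -
    have "norm (Ln z) \<le> norm z + K" using K[OF that] norm_ge_zero[of z] by linarith
    also have "\<dots> \<le> exp (norm z + K)" using exp_ge_add_one_self[of "norm z + K"] by linarith
    finally show ?thesis by (simp add: exp_add mult.commute)
  qed
  then show ?thesis by (rule that)
qed

lemma has_field_derivative_Ln_right_half: "Re z > 0 \<Longrightarrow> (Ln has_field_derivative inverse z) (at z)"
  by (intro has_field_derivative_Ln) (auto simp: complex_nonpos_Reals_iff)

lemma tame_Ln: "tame Ln"
proof -
  obtain K where K: "\<And>z. Re z \<ge> 1/2 \<Longrightarrow> norm (Ln z) \<le> K * exp (norm z)"
    by (rule Ln_bound) (rule that)
  show ?thesis by (rule tameI[OF has_field_derivative_Ln_right_half K])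
qed

text \<open>
  The analogue of Jensen's formula at the pole, where the antiderivative of \<open>1 / z\<close> is a
  logarithm; this is where Euler's constant enters the theorem.
\<close>
lemma vertical_mean_Ln: "vertical_mean Ln (1/2) = - euler_mascheroni"
proof -
  obtain K where K: "\<And>z. Re z \<ge> 1/2 \<Longrightarrow> norm (Ln z) \<le> K * exp (norm z)"
    by (rule Ln_bound) (rule that)
  have "(\<lambda>N. (\<Sum>n<N. inverse (of_nat (Suc n))) - Ln (of_real (real N + 1/2))) \<longlonglongrightarrow> - vertical_mean Ln (1/2)"
  proof (rule sum_minus_antiderivative_tendsto)
    show "(Ln has_field_derivative inverse z) (at z)" if "Re z > 0" for z
      using that by (rule has_field_derivative_Ln_right_half)
    show "norm (Ln z) \<le> K * exp (norm z)" if "Re z \<ge> 1/2" for z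
      using that by (rule K)
    have "norm (inverse z) \<le> inverse (real N + 1/2) * exp \<bar>Im z\<bar>" if z: "Re z = real N + 1/2" for N z
    proof -
      have "norm (inverse z) \<le> inverse (real N + 1/2)"
        unfolding norm_inverse using complex_Re_le_cmod[of z] z by (intro le_imp_inverse_le) auto
      also have "\<dots> * 1 \<le> inverse (real N + 1/2) * exp \<bar>Im z\<bar>"
        by (intro mult_left_mono) auto
      finally show ?thesis by simp
    qed
    then show "\<forall>\<^sub>F N in sequentially. \<forall>z. Re z = real N + 1/2 \<longrightarrow>
        norm (inverse z) \<le> inverse (real N + 1/2) * exp \<bar>Im z\<bar>"
      by simp
    show "(\<lambda>N. inverse (real N + 1/2)) \<longlonglongrightarrow> 0" by real_asymp
  qed
  moreover have "(\<lambda>N. (\<Sum>n<N. inverse (of_nat (Suc n))) - Ln (of_real (real N + 1/2)))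
      \<longlonglongrightarrow> (of_real euler_mascheroni :: complex)"
  proof -
    have "(\<lambda>N. (harm N - ln (real N)) + (ln (real N) - ln (real N + 1/2))) \<longlonglongrightarrow> euler_mascheroni + 0"
      by (intro tendsto_add euler_mascheroni_LIMSEQ) real_asymp
    then have "(\<lambda>N. of_real (harm N - ln (real N + 1/2))) \<longlonglongrightarrow> (of_real euler_mascheroni :: complex)"
      by (intro tendsto_of_real) simp
    moreover have "of_real (harm N - ln (real N + 1/2)) =
        (\<Sum>n<N. inverse (of_nat (Suc n))) - Ln (of_real (real N + 1/2))" for N
    proof -
      have "(\<Sum>n<N. inverse (of_nat (Suc n)) :: complex) = of_real (harm N)"
        by (simp add: harm_def sum.atLeast1_atMost_eq)
      then show ?thesis
        by (simp add: Ln_of_real del: of_real_add of_real_divide)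
    qed
    ultimately show ?thesis by simp
  qed
  ultimately have "- vertical_mean Ln (1/2) = of_real euler_mascheroni"
    by (rule LIMSEQ_unique)
  then show ?thesis by (simp add: minus_equation_iff)
qed

section \<open>An incomplete gamma function for all real exponents\<close>

text \<open>
  Integrating the power series of \<open>exp (- z) * z powr (b - 1)\<close> termwise gives the lower incomplete
  gamma function.  For a nonpositive integer \<open>b\<close> the term with exponent -1 integrates to a
  logarithm instead of a power.
\<close>
definition gamma_prim_term :: "real \<Rightarrow> nat \<Rightarrow> complex \<Rightarrow> complex" where
  "gamma_prim_term b k z = (-1) ^ k / fact k *
     (if b + real k = 0 then Ln z else z powr of_real (b + real k) / of_real (b + real k))"

definition gamma_prim :: "real \<Rightarrow> complex \<Rightarrow> complex" where
  "gamma_prim b z = (\<Sum>k. gamma_prim_term b k z)"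

text \<open>
  The coefficients of \<open>gamma_prim b z / z powr b\<close> as a power series in \<open>z\<close>.  The convention
  \<open>inverse 0 = 0\<close> drops the logarithmic term, whose coefficient is \<open>log_coeff b\<close>.
\<close>
definition gamma_prim_coeff :: "real \<Rightarrow> nat \<Rightarrow> complex" where
  "gamma_prim_coeff b k = (-1) ^ k / fact k * of_real (inverse (b + real k))"

definition gamma_prim_series :: "real \<Rightarrow> complex \<Rightarrow> complex" where
  "gamma_prim_series b z = (\<Sum>k. gamma_prim_coeff b k * z ^ k)"

definition log_coeff :: "real \<Rightarrow> complex" where
  "log_coeff b = (\<Sum>k. if b + real k = 0 then (-1) ^ k / fact k else 0)"

lemma indicator_sums:
  fixes f :: "nat \<Rightarrow> complex"
  shows "(\<lambda>k. if b + real k = 0 then f k else 0) sums (\<Sum>k. if b + real k = 0 then f k else 0)"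
proof (cases "\<exists>M. b + real M = 0")
  case True
  then obtain M where M: "b = - real M" by (metis add_eq_0_iff2)
  then have "(\<lambda>k. if b + real k = 0 then f k else 0) = (\<lambda>k. if k = M then f k else 0)"
    by (auto simp: fun_eq_iff)
  then show ?thesis using sums_single[of M f] by (simp add: sums_iff)
next
  case False
  then have "(\<lambda>k. if b + real k = 0 then f k else 0) = (\<lambda>k. 0)" by auto
  then show ?thesis by simp
qed

lemma log_coeff_neg: "log_coeff (- real M) = (-1) ^ M / fact M"
  unfolding log_coeff_def using sums_single[of M "\<lambda>k. (-1) ^ k / fact k :: complex"]
  by (simp add: sums_iff cong: if_cong)

lemma log_coeff_0: "(\<And>M::nat. b + real M \<noteq> 0) \<Longrightarrow> log_coeff b = 0"
  by (simp add: log_coeff_def)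

lemma gamma_prim_coeff_bound: obtains B where "B \<ge> 0" "\<And>k. norm (gamma_prim_coeff b k) \<le> B / fact k"
proof -
  have "(\<lambda>k. inverse (b + real k)) \<longlonglongrightarrow> 0" by real_asymp
  then have "Bseq (\<lambda>k. inverse (b + real k))"
    by (intro convergent_imp_Bseq convergentI)
  then obtain B where B: "B > 0" "\<And>k. norm (inverse (b + real k)) \<le> B"
    by (auto simp: Bseq_def)
  have "norm (gamma_prim_coeff b k) \<le> B / fact k" for k
  proof -
    have "norm (gamma_prim_coeff b k) = norm (inverse (b + real k)) / fact k"
      unfolding gamma_prim_coeff_def norm_mult norm_divide norm_power norm_of_real by simp
    also have "\<dots> \<le> B / fact k" by (intro divide_right_mono B) auto
    finally show ?thesis .
  qed
  with B(1) show ?thesis by (intro that[of B]) auto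
qed

lemma sums_exp_divide: "(\<lambda>k. x ^ k / fact k) sums exp x" for x :: real
  using exp_converges[of x] by (simp add: divide_inverse_commute)

lemma gamma_prim_series_summable: "summable (\<lambda>k. gamma_prim_coeff b k * z ^ k)"
proof -
  obtain B where B: "\<And>k. norm (gamma_prim_coeff b k) \<le> B / fact k"
    by (rule gamma_prim_coeff_bound[of b]) (rule that)
  have "summable (\<lambda>k. B * (norm z ^ k / fact k))"
    by (rule summable_mult[OF sums_summable[OF sums_exp_divide]])
  moreover have "norm (gamma_prim_coeff b k * z ^ k) \<le> B * (norm z ^ k / fact k)" for k
    using mult_right_mono[OF B[of k], of "norm z ^ k"] by (simp add: norm_mult norm_power)
  ultimately show ?thesis
    by (rule summable_comparison_test'[where N = 0])
qed

lemma exp_uminus_sums: "(\<lambda>k. (-1) ^ k / fact k * z ^ k) sums exp (- z :: complex)"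
proof -
  have "(-1) ^ k / fact k * z ^ k = (- z) ^ k /\<^sub>R fact k" for k
    unfolding power_minus[of z] scaleR_conv_of_real by (simp add: field_simps)
  then show ?thesis using exp_converges[of "- z"] by simp
qed

lemma powr_add_nat:
  "z \<noteq> 0 \<Longrightarrow> z powr of_real (b + real k) = z powr of_real b * z ^ k" for z :: complex
  by (simp add: powr_add)

lemma gamma_prim_term_sums_aux:
  assumes z: "z \<noteq> 0"
  shows "(\<lambda>k. gamma_prim_term b k z) sums (z powr of_real b * gamma_prim_series b z + log_coeff b * Ln z)"
proof -
  have "(\<lambda>k. z powr of_real b * (gamma_prim_coeff b k * z ^ k)) sums (z powr of_real b * gamma_prim_series b z)"
    unfolding gamma_prim_series_def by (intro sums_mult summable_sums gamma_prim_series_summable)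
  moreover have "(\<lambda>k. (if b + real k = 0 then (-1) ^ k / fact k else 0) * Ln z) sums (log_coeff b * Ln z)"
    unfolding log_coeff_def by (intro sums_mult2 indicator_sums)
  ultimately have "(\<lambda>k. z powr of_real b * (gamma_prim_coeff b k * z ^ k) + (if b + real k = 0 then (-1) ^ k / fact k else 0) * Ln z)
     sums (z powr of_real b * gamma_prim_series b z + log_coeff b * Ln z)"
    by (rule sums_add)
  moreover have "z powr of_real b * (gamma_prim_coeff b k * z ^ k) + (if b + real k = 0 then (-1) ^ k / fact k else 0) * Ln z
      = gamma_prim_term b k z" for k
    by (cases "b + real k = 0")
      (simp_all add: gamma_prim_term_def gamma_prim_coeff_def powr_add_nat[OF z] divide_inverse mult_ac del: of_real_add)
  ultimately show ?thesis by simp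
qed

lemma gamma_prim_eq: "z \<noteq> 0 \<Longrightarrow> gamma_prim b z = z powr of_real b * gamma_prim_series b z + log_coeff b * Ln z"
  unfolding gamma_prim_def using gamma_prim_term_sums_aux by (simp add: sums_iff)

lemma gamma_prim_term_sums: "z \<noteq> 0 \<Longrightarrow> (\<lambda>k. gamma_prim_term b k z) sums gamma_prim b z"
  using gamma_prim_term_sums_aux gamma_prim_eq by simp

lemma gamma_prim_term_partial_sum_bound:
  obtains C where "\<And>z n. z \<noteq> 0 \<Longrightarrow>
    (\<Sum>k<n. norm (gamma_prim_term b k z)) \<le> C * norm z powr b * exp (norm z) + norm (Ln z)"
proof -
  obtain B where B: "B \<ge> 0" "\<And>k. norm (gamma_prim_coeff b k) \<le> B / fact k"
    by (rule gamma_prim_coeff_bound[of b]) (rule that)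
  have "(\<Sum>k<n. norm (gamma_prim_term b k z)) \<le> B * norm z powr b * exp (norm z) + norm (Ln z)"
    if z: "z \<noteq> 0" for z n
  proof -
    have "norm (gamma_prim_term b k z) \<le> B * norm z powr b * (norm z ^ k / fact k) + (if b + real k = 0 then norm (Ln z) else 0)" for k
    proof (cases "b + real k = 0")
      case True
      have "norm (gamma_prim_term b k z) = norm (Ln z) / fact k"
        using True by (simp add: gamma_prim_term_def norm_mult norm_divide norm_power)
      also have "\<dots> \<le> norm (Ln z) / 1"
        by (intro divide_left_mono) auto
      finally show ?thesis using True B(1) by (simp add: add_increasing)
    next
      case False
      have "gamma_prim_term b k z = z powr of_real b * (gamma_prim_coeff b k * z ^ k)"
        using False by (simp add: gamma_prim_term_def gamma_prim_coeff_def powr_add_nat[OF z] divide_inverse mult_ac del: of_real_add)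
      also have "norm \<dots> = norm z powr b * (norm (gamma_prim_coeff b k) * norm z ^ k)"
        by (simp add: norm_mult norm_power norm_powr_real_powr')
      also have "\<dots> \<le> norm z powr b * (B / fact k * norm z ^ k)"
        by (intro mult_left_mono mult_right_mono B) auto
      finally show ?thesis using False by (simp add: mult_ac)
    qed
    then have "(\<Sum>k<n. norm (gamma_prim_term b k z)) \<le>
        (\<Sum>k<n. B * norm z powr b * (norm z ^ k / fact k) + (if b + real k = 0 then norm (Ln z) else 0))"
      by (rule sum_mono)
    also have "\<dots> = B * norm z powr b * (\<Sum>k<n. norm z ^ k / fact k) + (\<Sum>k<n. if b + real k = 0 then norm (Ln z) else 0)"
      by (simp add: sum.distrib sum_distrib_left)
    also have "\<dots> \<le> B * norm z powr b * exp (norm z) + norm (Ln z)"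
    proof (intro add_mono mult_left_mono exp_partial_sum_le)
      have "(\<Sum>k<n. if b + real k = 0 then norm (Ln z) else 0) = (\<Sum>k | k < n \<and> b + real k = 0. norm (Ln z))"
        by (simp add: sum.If_cases Int_def)
      also have "\<dots> = real (card {k. k < n \<and> b + real k = 0}) * norm (Ln z)" by simp
      also have "card {k. k < n \<and> b + real k = 0} \<le> 1"
        by (rule card_le_Suc0_iff_eq[THEN iffD2, unfolded One_nat_def[symmetric]]) auto
      then have "real (card {k. k < n \<and> b + real k = 0}) * norm (Ln z) \<le> 1 * norm (Ln z)"
        by (intro mult_right_mono) auto
      finally show "(\<Sum>k<n. if b + real k = 0 then norm (Ln z) else 0) \<le> norm (Ln z)" by simp
    qed (use B(1) in auto)
    finally show ?thesis .
  qed
  then show ?thesis by (rule that)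
qed

lemma log_coeff_mult_powr:
  assumes "z \<noteq> 0"
  shows "(\<lambda>k. if b + real k = 0 then (-1) ^ k / fact k * z ^ k else 0) sums (log_coeff b * z powr of_real (- b))"
proof -
  have "(\<lambda>k. (if b + real k = 0 then (-1) ^ k / fact k else 0) * z powr of_real (- b)) sums (log_coeff b * z powr of_real (- b))"
    unfolding log_coeff_def by (intro sums_mult2 indicator_sums)
  moreover have "(if b + real k = 0 then (-1) ^ k / fact k else 0) * z powr of_real (- b) =
      (if b + real k = 0 then (-1) ^ k / fact k * z ^ k else 0)" for k
  proof (cases "b + real k = 0")
    case True
    then have "- b = real k" by simp
    then have "z powr of_real (- b) = z ^ k"
      using powr_nat'[of z k] assms by simp
    then show ?thesis using True by simp
  qed simp
  ultimately show ?thesis by simp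
qed

lemma gamma_prim_has_field_derivative:
  assumes z: "z \<notin> \<real>\<^sub>\<le>\<^sub>0"
  shows "(gamma_prim b has_field_derivative exp (- z) * z powr of_real (b - 1)) (at z)"
proof -
  have z0: "z \<noteq> 0" using z by auto
  define D where "D = (\<Sum>k. diffs (gamma_prim_coeff b) k * z ^ k)"
  have dR: "(gamma_prim_series b has_field_derivative D) (at z)"
    unfolding gamma_prim_series_def D_def by (intro termdiffs_strong_converges_everywhere gamma_prim_series_summable)
  have "summable (\<lambda>k. diffs (gamma_prim_coeff b) k * z ^ k)"
    by (rule termdiff_converges_all) (rule gamma_prim_series_summable)
  then have "(\<lambda>k. z * (diffs (gamma_prim_coeff b) k * z ^ k)) sums (z * D)"
    unfolding D_def by (intro sums_mult summable_sums)
  moreover have "z * (diffs (gamma_prim_coeff b) k * z ^ k) = of_nat (Suc k) * gamma_prim_coeff b (Suc k) * z ^ Suc k" for k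
    by (simp add: diffs_def mult_ac)
  ultimately have "(\<lambda>k. of_nat k * gamma_prim_coeff b k * z ^ k) sums (z * D)"
    using sums_Suc_iff[of "\<lambda>k. of_nat k * gamma_prim_coeff b k * z ^ k" "z * D"] by simp
  moreover have "(\<lambda>k. of_real b * (gamma_prim_coeff b k * z ^ k)) sums (of_real b * gamma_prim_series b z)"
    unfolding gamma_prim_series_def by (intro sums_mult summable_sums gamma_prim_series_summable)
  ultimately have "(\<lambda>k. of_real b * (gamma_prim_coeff b k * z ^ k) + of_nat k * gamma_prim_coeff b k * z ^ k)
     sums (of_real b * gamma_prim_series b z + z * D)"
    by (intro sums_add)
  moreover have "of_real b * (gamma_prim_coeff b k * z ^ k) + of_nat k * gamma_prim_coeff b k * z ^ k =
      (-1) ^ k / fact k * z ^ k - (if b + real k = 0 then (-1) ^ k / fact k * z ^ k else 0)" for k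
  proof -
    have "of_real b * (gamma_prim_coeff b k * z ^ k) + of_nat k * gamma_prim_coeff b k * z ^ k
        = (-1) ^ k / fact k * z ^ k * of_real ((b + real k) * inverse (b + real k))"
      by (simp add: gamma_prim_coeff_def algebra_simps)
    also have "(b + real k) * inverse (b + real k) = (if b + real k = 0 then 0 else 1)"
      by simp
    finally show ?thesis by simp
  qed
  moreover have "(\<lambda>k. (-1) ^ k / fact k * z ^ k - (if b + real k = 0 then (-1) ^ k / fact k * z ^ k else 0))
      sums (exp (- z) - log_coeff b * z powr of_real (- b))"
    by (intro sums_diff exp_uminus_sums log_coeff_mult_powr z0)
  ultimately have eq: "of_real b * gamma_prim_series b z + z * D = exp (- z) - log_coeff b * z powr of_real (- b)"
    using sums_unique2 by (metis (no_types, lifting) sums_cong)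
  have "((\<lambda>z. z powr of_real b * gamma_prim_series b z + log_coeff b * Ln z) has_field_derivative
      (of_real b * z powr (of_real b - 1) * gamma_prim_series b z + D * z powr of_real b + log_coeff b * inverse z)) (at z)"
    by (intro DERIV_add DERIV_mult has_field_derivative_powr z dR DERIV_cmult has_field_derivative_Ln)
  also have "of_real b * z powr (of_real b - 1) * gamma_prim_series b z + D * z powr of_real b + log_coeff b * inverse z
      = z powr (of_real b - 1) * (of_real b * gamma_prim_series b z + z * D) + log_coeff b * inverse z"
  proof -
    have "z powr of_real b = z powr (of_real b - 1) * z"
      using powr_add[of z "of_real b - 1" 1] z0 by simp
    then show ?thesis by (simp add: algebra_simps)
  qed
  also have "\<dots> = exp (- z) * z powr of_real (b - 1)"
  proof -
    have "z powr (of_real b - 1) * z powr of_real (- b) = inverse z"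
      using z0 by (simp add: powr_minus powr_diff divide_inverse)
    then show ?thesis unfolding eq by (simp add: algebra_simps)
  qed
  finally have "((\<lambda>z. z powr of_real b * gamma_prim_series b z + log_coeff b * Ln z) has_field_derivative
      exp (- z) * z powr of_real (b - 1)) (at z)" .
  then show ?thesis
  proof (rule has_field_derivative_transform_within_open)
    show "open (- {0::complex})" "z \<in> - {0}" using z0 by auto
  qed (auto simp: gamma_prim_eq)
qed

text \<open>
  Integration by parts, read off the coefficients.  It carries the limits at infinity from
  \<open>b + 1\<close> down to \<open>b\<close> in the same way as the functional equations of Gamma and Digamma.
\<close>
lemma gamma_prim_recurrence:
  assumes z: "z \<noteq> 0"
  shows "of_real b * gamma_prim b z - gamma_prim (b + 1) z = z powr of_real b * exp (- z) - log_coeff b"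
proof -
  have "of_nat (Suc k) * gamma_prim_term b (Suc k) z = - gamma_prim_term (b + 1) k z" for k
  proof -
    have eqb: "b + real (Suc k) = (b + 1) + real k" by simp
    have "of_nat (Suc k) * ((-1) ^ Suc k / fact (Suc k)) = (- ((-1) ^ k / fact k) :: complex)"
    proof -
      have "(of_nat (Suc k) :: complex) \<noteq> 0" by (simp del: of_nat_Suc)
      then show ?thesis by (simp add: fact_Suc del: of_nat_Suc)
    qed
    then show ?thesis
      by (simp only: gamma_prim_term_def eqb mult.assoc[symmetric] mult_minus_left)
  qed
  then have "(\<lambda>k. of_nat (Suc k) * gamma_prim_term b (Suc k) z) sums (- gamma_prim (b + 1) z)"
    using sums_minus[OF gamma_prim_term_sums[OF z, of "b + 1"]] by simp
  then have "(\<lambda>k. of_nat k * gamma_prim_term b k z) sums (- gamma_prim (b + 1) z)"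
    using sums_Suc_iff[of "\<lambda>k. of_nat k * gamma_prim_term b k z"] by simp
  then have "(\<lambda>k. of_real b * gamma_prim_term b k z + of_nat k * gamma_prim_term b k z) sums (of_real b * gamma_prim b z + - gamma_prim (b + 1) z)"
    by (intro sums_add sums_mult gamma_prim_term_sums z)
  moreover have "of_real b * gamma_prim_term b k z + of_nat k * gamma_prim_term b k z =
      z powr of_real b * ((-1) ^ k / fact k * z ^ k) - (if b + real k = 0 then (-1) ^ k / fact k else 0)" for k
  proof -
    have "of_real b * gamma_prim_term b k z + of_nat k * gamma_prim_term b k z = of_real (b + real k) * gamma_prim_term b k z"
      by (simp add: algebra_simps)
    also have "\<dots> = z powr of_real b * ((-1) ^ k / fact k * z ^ k) - (if b + real k = 0 then (-1) ^ k / fact k else 0)"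
    proof (cases "b + real k = 0")
      case True
      have "z powr of_real b * z ^ k = 1"
        using powr_add_nat[OF z, of b k] True z by simp
      then have "z powr of_real b * ((-1) ^ k / fact k * z ^ k) = (-1) ^ k / fact k"
        by (metis mult.left_commute mult.right_neutral)
      then show ?thesis using True by simp
    next
      case False
      then have "of_real (b + real k) \<noteq> (0::complex)" by (simp del: of_real_add)
      then show ?thesis using False
        by (simp add: gamma_prim_term_def powr_add_nat[OF z] mult_ac del: of_real_add)
    qed
    finally show ?thesis .
  qed
  moreover have "(\<lambda>k. z powr of_real b * ((-1) ^ k / fact k * z ^ k) - (if b + real k = 0 then (-1) ^ k / fact k else 0))
     sums (z powr of_real b * exp (- z) - log_coeff b)"
    unfolding log_coeff_def by (intro sums_diff sums_mult exp_uminus_sums indicator_sums)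
  ultimately show ?thesis
    using sums_unique2 by (simp add: sums_iff)
qed

section \<open>Limits of the incomplete gamma function\<close>
lemma has_integral_half_line_tendsto:
  fixes f :: "real \<Rightarrow> complex"
  assumes "(f has_integral I) {0..}"
  shows "((\<lambda>x. integral {0..x} f) \<longlongrightarrow> I) at_top"
proof (rule tendstoI)
  fix e :: real assume "e > 0"
  then obtain B where B: "B > 0" "\<And>a b. ball 0 B \<subseteq> cbox a b \<Longrightarrow>
      norm (integral (cbox a b) (\<lambda>x. if x \<in> {0..} then f x else 0) - I) < e"
    using assms unfolding has_integral_alt' by metis
  have "dist (integral {0..x} f) I < e" if x: "x \<ge> B" for x
  proof -
    have "ball 0 B \<subseteq> cbox (- x) x" using x by auto
    note B(2)[OF this]
    moreover have "integral (cbox (- x) x) (\<lambda>x. if x \<in> {0..} then f x else 0) = integral {0..x} f"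
    proof -
      have "cbox (- x) x \<inter> {0..} = {0..x}" using x B(1) by auto
      then show ?thesis by (simp only: integral_restrict_Int Int_commute)
    qed
    ultimately show ?thesis by (simp add: dist_norm)
  qed
  then show "\<forall>\<^sub>F x in at_top. dist (integral {0..x} f) I < e"
    by (rule eventually_mono[OF eventually_ge_at_top[of B]])
qed

lemma gamma_prim_real_vector_derivative:
  assumes "t > 0"
  shows "((\<lambda>t. gamma_prim b (of_real t)) has_vector_derivative
           (of_real t powr (of_real b - 1) / of_real (exp t))) (at t)"
proof -
  have "(gamma_prim b has_field_derivative exp (- of_real t) * of_real t powr of_real (b - 1)) (at (of_real t))"
    using assms by (intro gamma_prim_has_field_derivative) (simp add: complex_nonpos_Reals_iff)
  from has_vector_derivative_real_field[OF this, of UNIV] show ?thesis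
    by (simp add: exp_minus divide_inverse mult.commute exp_of_real)
qed

text \<open>
  For positive \<open>b\<close> the function vanishes at 0, hence is the truncated Euler integral.
\<close>
lemma gamma_prim_tendsto_Gamma_pos:
  assumes b: "b > 0"
  shows "((\<lambda>x. gamma_prim b (of_real x)) \<longlongrightarrow> Gamma (of_real b)) at_top"
proof -
  let ?f = "\<lambda>t::real. of_real t powr (of_real b - 1) / of_real (exp t) :: complex"
  have eq: "gamma_prim b (of_real t) = of_real (t powr b) * gamma_prim_series b (of_real t)" if "t \<ge> 0" for t
  proof (cases "t = 0")
    case True
    have "gamma_prim_term b k 0 = 0" for k
      using b by (simp add: gamma_prim_term_def)
    then show ?thesis using True by (simp add: gamma_prim_def)
  next
    case False
    then show ?thesis
      using that b log_coeff_0[of b] by (simp add: gamma_prim_eq powr_of_real add_pos_nonneg add_nonneg_eq_0_iff)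
  qed
  have cR: "continuous_on UNIV (gamma_prim_series b)"
  proof (rule continuous_at_imp_continuous_on, rule ballI)
    fix z :: complex
    show "isCont (gamma_prim_series b) z"
      unfolding gamma_prim_series_def
      by (rule DERIV_isCont[OF termdiffs_strong_converges_everywhere[OF gamma_prim_series_summable]])
  qed
  have "integral {0..x} ?f = gamma_prim b (of_real x)" if x: "x > 0" for x
  proof -
    have "continuous_on {0..x} (\<lambda>t. of_real (t powr b) * gamma_prim_series b (of_real t))"
      using b by (intro continuous_intros continuous_on_powr' continuous_on_compose2[OF cR]) auto
    then have "continuous_on {0..x} (\<lambda>t. gamma_prim b (of_real t))"
      by (rule continuous_on_eq) (simp add: eq)
    then have "(?f has_integral (gamma_prim b (of_real x) - gamma_prim b (of_real 0))) {0..x}"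
      using x by (intro fundamental_theorem_of_calculus_interior gamma_prim_real_vector_derivative) auto
    moreover have "gamma_prim b (of_real 0) = 0" using eq[of 0] by simp
    ultimately show ?thesis by (simp add: integral_unique)
  qed
  then have "\<forall>\<^sub>F x in at_top. integral {0..x} ?f = gamma_prim b (of_real x)"
    by (intro eventually_mono[OF eventually_gt_at_top[of 0]])
  moreover have "((\<lambda>x. integral {0..x} ?f) \<longlongrightarrow> Gamma (of_real b)) at_top"
    using b by (intro has_integral_half_line_tendsto Gamma_integral_complex) simp
  ultimately show ?thesis by (rule Lim_transform_eventually[rotated])
qed

text \<open>
  Uniformity in \<open>b\<close> is the point: it allows \<open>b\<close> to tend to 0 below.
\<close>
lemma gamma_prim_tail_bound:
  assumes "0 < b" "b \<le> 1" "x \<ge> 1"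
  shows "norm (Gamma (of_real b) - gamma_prim b (of_real x)) \<le> exp (- x)"
proof (rule tendsto_upperbound)
  show "((\<lambda>y. norm (gamma_prim b (of_real y) - gamma_prim b (of_real x))) \<longlongrightarrow> norm (Gamma (of_real b) - gamma_prim b (of_real x))) at_top"
    by (intro tendsto_intros gamma_prim_tendsto_Gamma_pos assms)
  have "norm (gamma_prim b (of_real y) - gamma_prim b (of_real x)) \<le> exp (- x)" if y: "y > x" for y
  proof -
    have "norm (gamma_prim b (of_real y) - gamma_prim b (of_real x)) \<le> - exp (- y) - (- exp (- x))"
    proof (rule differentiable_bound_general[OF y])
      show "continuous_on {x..y} (\<lambda>t. gamma_prim b (of_real t))"
        using assms(3)
        by (intro continuous_at_imp_continuous_on ballI
            has_vector_derivative_continuous[OF gamma_prim_real_vector_derivative]) auto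
      show "continuous_on {x..y} (\<lambda>t. - exp (- t))" by (intro continuous_intros)
      fix t assume t: "x < t" "t < y"
      show "((\<lambda>t. gamma_prim b (of_real t)) has_vector_derivative
           (of_real t powr (of_real b - 1) / of_real (exp t))) (at t)"
        using t assms(3) by (intro gamma_prim_real_vector_derivative) simp
      show "((\<lambda>t. - exp (- t)) has_vector_derivative exp (- t)) (at t)"
        unfolding has_real_derivative_iff_has_vector_derivative[symmetric]
        by (auto intro!: derivative_eq_intros)
      have "norm (of_real t powr (of_real b - 1) / of_real (exp t) :: complex) = t powr (b - 1) / exp t"
        using t assms by (simp add: norm_divide norm_powr_real_powr)
      also have "\<dots> \<le> 1 / exp t"
        using t assms by (intro divide_right_mono) (auto simp: powr_le1 powr_mono[of "b - 1" 0 t, simplified])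
      finally show "norm (of_real t powr (of_real b - 1) / of_real (exp t) :: complex) \<le> exp (- t)"
        by (simp add: exp_minus inverse_eq_divide)
    qed
    then show ?thesis using exp_ge_zero[of "- y"] by linarith
  qed
  then show "\<forall>\<^sub>F y in at_top. norm (gamma_prim b (of_real y) - gamma_prim b (of_real x)) \<le> exp (- x)"
    by (rule eventually_mono[OF eventually_gt_at_top[of x]])
qed simp

text \<open>
  \<open>Gamma b - 1 / b\<close> is the difference quotient of Gamma at 1.
\<close>
lemma Gamma_minus_inverse_tendsto:
  "((\<lambda>b::real. Gamma (of_real b) - of_real (inverse b)) \<longlongrightarrow> (- euler_mascheroni :: complex)) (at_right 0)"
proof -
  have "(Gamma has_field_derivative Gamma 1 * Digamma 1) (at (1::real))"
    by (rule has_field_derivative_Gamma) auto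
  then have "((\<lambda>h::real. (Gamma (1 + h) - Gamma 1) / h) \<longlongrightarrow> - euler_mascheroni) (at 0)"
    by (simp add: DERIV_def)
  then have "((\<lambda>h::real. (Gamma (1 + h) - Gamma 1) / h) \<longlongrightarrow> - euler_mascheroni) (at_right 0)"
    by (rule tendsto_mono[rotated]) (simp add: at_le)
  moreover have "\<forall>\<^sub>F h in at_right 0. (Gamma (1 + h) - Gamma 1) / h = Gamma h - inverse (h::real)"
  proof (rule eventually_mono[OF eventually_at_right_less])
    fix h :: real assume h: "0 < h"
    then have "Gamma (1 + h) = h * Gamma h"
    proof -
      have "h \<notin> \<int>\<^sub>\<le>\<^sub>0" using h by (auto elim!: nonpos_Ints_cases)
      from Gamma_plus1[OF this] show ?thesis by (simp add: add.commute)
    qed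
    then show "(Gamma (1 + h) - Gamma 1) / h = Gamma h - inverse h"
      using h by (simp add: field_simps)
  qed
  ultimately have "((\<lambda>h::real. Gamma h - inverse h) \<longlongrightarrow> - euler_mascheroni) (at_right 0)"
    by (rule Lim_transform_eventually)
  from tendsto_of_real[OF this, where 'a = complex] show ?thesis
    by (simp add: Gamma_complex_of_real)
qed

lemma gamma_prim_series_near_0:
  assumes b: "b > 0" and x: "x \<ge> 0"
  shows "norm (gamma_prim_series b (of_real x) - of_real (inverse b) - gamma_prim_series 0 (of_real x)) \<le> b * exp x"
proof -
  have s: "(\<lambda>k. (gamma_prim_coeff b k - gamma_prim_coeff 0 k) * of_real x ^ k) sums (gamma_prim_series b (of_real x) - gamma_prim_series 0 (of_real x))"
    unfolding gamma_prim_series_def left_diff_distrib by (intro sums_diff summable_sums gamma_prim_series_summable)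
  have "(\<lambda>k. if k = 0 then of_real (inverse b) else 0 :: complex) sums of_real (inverse b)"
    using sums_single[of 0 "\<lambda>_. of_real (inverse b) :: complex"] by simp
  from sums_diff[OF s this]
  have s': "(\<lambda>k. (gamma_prim_coeff b k - gamma_prim_coeff 0 k) * of_real x ^ k - (if k = 0 then of_real (inverse b) else 0))
     sums (gamma_prim_series b (of_real x) - of_real (inverse b) - gamma_prim_series 0 (of_real x))"
    by (simp add: algebra_simps)
  have bd: "norm ((gamma_prim_coeff b k - gamma_prim_coeff 0 k) * of_real x ^ k - (if k = 0 then of_real (inverse b) else 0))
      \<le> b * (x ^ k / fact k)" for k
  proof (cases "k = 0")
    case True
    then show ?thesis using b by (simp add: gamma_prim_coeff_def)
  next
    case False
    then have k: "real k \<ge> 1" by simp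
    have "inverse (b + real k) - inverse (0 + real k) = - (b / ((b + real k) * real k))"
      using b k by (simp add: field_simps)
    then have "\<bar>inverse (b + real k) - inverse (0 + real k)\<bar> = b / ((b + real k) * real k)"
      using b k by simp
    also have "\<dots> \<le> b / 1"
    proof (intro divide_left_mono)
      show "1 \<le> (b + real k) * real k"
        using mult_mono[of 1 "b + real k" 1 "real k"] b k by simp
    qed (use b k in auto)
    finally have le: "\<bar>inverse (b + real k) - inverse (0 + real k)\<bar> \<le> b" by simp
    have "(gamma_prim_coeff b k - gamma_prim_coeff 0 k) * of_real x ^ k
        = (-1) ^ k / fact k * of_real (inverse (b + real k) - inverse (0 + real k)) * of_real x ^ k"
      unfolding gamma_prim_coeff_def of_real_diff by (simp add: right_diff_distrib)
    then have "norm ((gamma_prim_coeff b k - gamma_prim_coeff 0 k) * of_real x ^ k)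
        = \<bar>inverse (b + real k) - inverse (0 + real k)\<bar> * (x ^ k / fact k)"
      using x by (simp only: norm_mult norm_divide norm_power norm_of_real) simp
    also have "\<dots> \<le> b * (x ^ k / fact k)" by (intro mult_right_mono le) (use x in auto)
    finally show ?thesis using False by simp
  qed
  have "(\<lambda>k. b * (x ^ k / fact k)) sums (b * exp x)"
    by (intro sums_mult sums_exp_divide)
  from norm_sums_le[OF s' this bd] show ?thesis .
qed

text \<open>
  Let \<open>b\<close> tend to 0 from above in the tail bound.  Both Gamma and the incomplete function
  have the singular part \<open>1 / b\<close>; after cancelling it, the former leaves
  \<open>- euler_mascheroni\<close> and \<open>(x powr b - 1) / b\<close> becomes the logarithm.
\<close>
lemma gamma_prim_0_tail_bound:
  assumes x: "x \<ge> 1"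
  shows "norm (- euler_mascheroni - gamma_prim 0 (of_real x)) \<le> exp (- x)"
proof (rule tendsto_upperbound)
  have P0: "gamma_prim 0 (of_real x) = gamma_prim_series 0 (of_real x) + of_real (ln x)"
    using x log_coeff_neg[of 0] by (simp add: gamma_prim_eq Ln_of_real)
  have A: "((\<lambda>b. of_real ((x powr b - 1) / b)) \<longlongrightarrow> (of_real (ln x) :: complex)) (at_right 0)"
  proof (rule tendsto_of_real)
    have "((\<lambda>b. x powr b) has_real_derivative ln x) (at 0)"
      using x by (auto intro!: derivative_eq_intros)
    then have "((\<lambda>b. (x powr b - 1) / b) \<longlongrightarrow> ln x) (at 0)"
      using x by (simp add: DERIV_def)
    then show "((\<lambda>b. (x powr b - 1) / b) \<longlongrightarrow> ln x) (at_right 0)"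
      by (rule tendsto_mono[rotated]) (simp add: at_le)
  qed
  have B: "((\<lambda>b. gamma_prim_series b (of_real x) - of_real (inverse b)) \<longlongrightarrow> gamma_prim_series 0 (of_real x)) (at_right 0)"
  proof (rule LIM_zero_cancel, rule Lim_null_comparison)
    show "\<forall>\<^sub>F b in at_right 0. norm (gamma_prim_series b (of_real x) - of_real (inverse b) - gamma_prim_series 0 (of_real x)) \<le> b * exp x"
      by (rule eventually_mono[OF eventually_at_right_less]) (rule gamma_prim_series_near_0, use x in auto)
    show "((\<lambda>b. b * exp x) \<longlongrightarrow> 0) (at_right 0)"
      by (intro tendsto_mult_left_zero tendsto_ident_at)
  qed
  have C: "((\<lambda>b. of_real (x powr b)) \<longlongrightarrow> (of_real (x powr 0) :: complex)) (at_right 0)"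
    using x by (intro tendsto_of_real tendsto_powr tendsto_const tendsto_ident_at) auto
  have "((\<lambda>b. (Gamma (of_real b) - of_real (inverse b)) - of_real ((x powr b - 1) / b)
       - of_real (x powr b) * (gamma_prim_series b (of_real x) - of_real (inverse b)))
      \<longlongrightarrow> - euler_mascheroni - of_real (ln x) - of_real (x powr 0) * gamma_prim_series 0 (of_real x)) (at_right 0)"
    by (intro tendsto_diff tendsto_mult Gamma_minus_inverse_tendsto A B C)
  moreover have "\<forall>\<^sub>F b in at_right 0. (Gamma (of_real b) - of_real (inverse b)) - of_real ((x powr b - 1) / b)
       - of_real (x powr b) * (gamma_prim_series b (of_real x) - of_real (inverse b))
       = Gamma (of_real b) - gamma_prim b (of_real x)"
  proof (rule eventually_mono[OF eventually_at_right_less])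
    fix b :: real assume b: "0 < b"
    have "gamma_prim b (of_real x) = of_real (x powr b) * gamma_prim_series b (of_real x)"
      using x b log_coeff_0[of b] by (simp add: gamma_prim_eq powr_of_real add_pos_nonneg add_nonneg_eq_0_iff)
    then show "(Gamma (of_real b) - of_real (inverse b)) - of_real ((x powr b - 1) / b)
       - of_real (x powr b) * (gamma_prim_series b (of_real x) - of_real (inverse b))
       = Gamma (of_real b) - gamma_prim b (of_real x)"
      by (simp add: divide_inverse algebra_simps)
  qed
  ultimately have "((\<lambda>b. Gamma (of_real b) - gamma_prim b (of_real x)) \<longlongrightarrow>
      - euler_mascheroni - of_real (ln x) - of_real (x powr 0) * gamma_prim_series 0 (of_real x)) (at_right 0)"
    by (rule Lim_transform_eventually)
  also have "- euler_mascheroni - of_real (ln x) - of_real (x powr 0) * gamma_prim_series 0 (of_real x)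
      = - euler_mascheroni - gamma_prim 0 (of_real x)"
    using x by (simp add: P0)
  finally show "((\<lambda>b. norm (Gamma (of_real b) - gamma_prim b (of_real x))) \<longlongrightarrow>
      norm (- euler_mascheroni - gamma_prim 0 (of_real x))) (at_right 0)"
    by (rule tendsto_norm)
  have "\<forall>\<^sub>F b in at_right 0. b \<in> {0<..<1::real}"
    by (rule eventually_at_right_real) simp
  then show "\<forall>\<^sub>F b in at_right 0. norm (Gamma (of_real b) - gamma_prim b (of_real x)) \<le> exp (- x)"
    by (rule eventually_mono) (use x in \<open>auto intro!: gamma_prim_tail_bound\<close>)
qed simp

lemma gamma_prim_recurrence_limit:
  "((\<lambda>x. of_real b * gamma_prim b (of_real x) - gamma_prim (b + 1) (of_real x)) \<longlongrightarrow> - log_coeff b) at_top"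
proof -
  have "((\<lambda>x::real. x powr b * exp (- x)) \<longlongrightarrow> 0) at_top" by real_asymp
  then have "((\<lambda>x. of_real (x powr b * exp (- x)) - log_coeff b) \<longlongrightarrow> of_real 0 - log_coeff b) at_top"
    by (intro tendsto_intros)
  moreover have "of_real (x powr b * exp (- x)) - log_coeff b
      = of_real b * gamma_prim b (of_real x) - gamma_prim (b + 1) (of_real x)" if "x > 0" for x
    using that gamma_prim_recurrence[of "of_real x" b] by (simp add: powr_of_real flip: exp_of_real)
  then have "\<forall>\<^sub>F x in at_top. of_real (x powr b * exp (- x)) - log_coeff b
      = of_real b * gamma_prim b (of_real x) - gamma_prim (b + 1) (of_real x)"
    by (intro eventually_mono[OF eventually_gt_at_top[of 0]])
  ultimately show ?thesis
    by (simp add: Lim_transform_eventually)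
qed

lemma gamma_prim_tendsto_of_Suc:
  assumes "((\<lambda>x. gamma_prim (b + 1) (of_real x)) \<longlongrightarrow> L) at_top" "b \<noteq> 0"
  shows "((\<lambda>x. gamma_prim b (of_real x)) \<longlongrightarrow> (L - log_coeff b) / of_real b) at_top"
proof -
  have "((\<lambda>x. ((of_real b * gamma_prim b (of_real x) - gamma_prim (b + 1) (of_real x)) + gamma_prim (b + 1) (of_real x)) / of_real b)
     \<longlongrightarrow> (- log_coeff b + L) / of_real b) at_top"
    using assms by (intro tendsto_intros gamma_prim_recurrence_limit) auto
  then show ?thesis using assms(2) by simp
qed

lemma gamma_prim_tendsto_Gamma:
  assumes "\<And>M::nat. b + real M \<noteq> 0"
  shows "((\<lambda>x. gamma_prim b (of_real x)) \<longlongrightarrow> Gamma (of_real b)) at_top"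
proof -
  obtain n :: nat where "- b < real n" using reals_Archimedean2 by blast
  then have "b + real n > 0" by simp
  with assms show ?thesis
  proof (induction n arbitrary: b)
    case (Suc n)
    have b0: "b \<noteq> 0" using Suc.prems(1)[of 0] by simp
    have "((\<lambda>x. gamma_prim (b + 1) (of_real x)) \<longlongrightarrow> Gamma (of_real (b + 1))) at_top"
    proof (rule Suc.IH)
      show "b + 1 + real M \<noteq> 0" for M using Suc.prems(1)[of "Suc M"] by (simp add: add_ac)
      show "0 < b + 1 + real n" using Suc.prems(2) by simp
    qed
    from gamma_prim_tendsto_of_Suc[OF this b0]
    have "((\<lambda>x. gamma_prim b (of_real x)) \<longlongrightarrow> Gamma (of_real (b + 1)) / of_real b) at_top"
      using log_coeff_0[OF Suc.prems(1)] by simp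
    moreover have "(of_real b :: complex) \<notin> \<int>\<^sub>\<le>\<^sub>0"
    proof
      assume "(of_real b :: complex) \<in> \<int>\<^sub>\<le>\<^sub>0"
      then obtain M :: nat where "(of_real b :: complex) = - of_nat M"
        by (elim nonpos_Ints_cases')
      then have "b = - real M"
        by (metis of_real_eq_iff of_real_minus of_real_of_nat_eq)
      then show False using Suc.prems(1)[of M] by simp
    qed
    then have "Gamma (of_real (b + 1)) / of_real b = (Gamma (of_real b) :: complex)"
      using b0 Gamma_plus1[of "of_real b :: complex"] by simp
    ultimately show ?case by simp
  qed (use gamma_prim_tendsto_Gamma_pos in simp)
qed

lemma gamma_prim_tendsto_Digamma:
  "((\<lambda>x. gamma_prim (- real M) (of_real x)) \<longlongrightarrow> (-1) ^ M / fact M * Digamma (of_nat (M + 1))) at_top"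
proof (induction M)
  case 0
  have "((\<lambda>x. - euler_mascheroni - gamma_prim 0 (of_real x)) \<longlongrightarrow> 0) at_top"
  proof (rule Lim_null_comparison)
    show "\<forall>\<^sub>F x in at_top. norm (- euler_mascheroni - gamma_prim 0 (of_real x)) \<le> exp (- x)"
      by (rule eventually_mono[OF eventually_ge_at_top[of 1]]) (rule gamma_prim_0_tail_bound)
    show "((\<lambda>x::real. exp (- x)) \<longlongrightarrow> 0) at_top" by real_asymp
  qed
  from tendsto_diff[OF tendsto_const[of "- euler_mascheroni"] this] show ?case by simp
next
  case (Suc M)
  have "((\<lambda>x. gamma_prim (- real (Suc M) + 1) (of_real x)) \<longlongrightarrow> (-1) ^ M / fact M * Digamma (of_nat (M + 1))) at_top"
    using Suc by simp
  from gamma_prim_tendsto_of_Suc[OF this]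
  have "((\<lambda>x. gamma_prim (- real (Suc M)) (of_real x)) \<longlongrightarrow>
      ((-1) ^ M / fact M * Digamma (of_nat (M + 1)) - (-1) ^ Suc M / fact (Suc M)) / of_real (- real (Suc M))) at_top"
    by (simp add: log_coeff_neg del: of_nat_Suc of_real_minus fact_Suc power_Suc)
  also have "((-1) ^ M / fact M * Digamma (of_nat (M + 1)) - (-1) ^ Suc M / fact (Suc M)) / of_real (- real (Suc M))
      = (-1) ^ Suc M / fact (Suc M) * (Digamma (of_nat (M + 1)) + 1 / of_nat (M + 1) :: complex)"
  proof -
    have nz: "(of_nat (Suc M) :: complex) \<noteq> 0" by (simp del: of_nat_Suc)
    define S where "S = (of_nat (Suc M) :: complex)"
    define D where "D = (Digamma S :: complex)"
    have "((-1) ^ M / fact M * D - (-1) ^ Suc M / (S * fact M)) / (- S)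
      = (-1) ^ Suc M / (S * fact M) * (D + 1 / S)"
      using nz unfolding S_def[symmetric] by (simp add: field_simps)
    then show ?thesis by (simp add: S_def D_def fact_Suc del: of_nat_Suc)
  qed
  also have "Digamma (of_nat (M + 1)) + 1 / of_nat (M + 1) = (Digamma (of_nat (Suc M + 1)) :: complex)"
    using Digamma_plus1[of "of_nat (M + 1) :: complex"] by (simp add: add_ac del: of_nat_Suc flip: of_nat_Suc)
  finally show ?case .
qed

text \<open>
  A complex \<open>a\<close> with positive real part is handled by rotating the ray: on the segment from
  \<open>norm a * x\<close> to \<open>a * x\<close> the real part stays above \<open>Re a * x\<close>, so the derivative is
  exponentially small there while the segment grows only linearly.
\<close>
lemma gamma_prim_tendsto_along_ray:
  assumes a: "Re a > 0" and lim: "((\<lambda>x. gamma_prim b (of_real x)) \<longlongrightarrow> L) at_top"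
  shows "((\<lambda>x. gamma_prim b (a * of_real x)) \<longlongrightarrow> L) at_top"
proof -
  define c A where "c = Re a" and "A = norm a"
  have cA: "0 < c" "c \<le> A" "0 < A"
    using a complex_Re_le_cmod[of a] by (auto simp: c_def A_def)
  have "((\<lambda>x. gamma_prim b (a * of_real x) - gamma_prim b (of_real (A * x))) \<longlongrightarrow> 0) at_top"
  proof (rule Lim_null_comparison)
    show "((\<lambda>x::real. exp (- (c * x)) * ((A * x) powr (b - 1) + (c * x) powr (b - 1)) * (2 * A * x)) \<longlongrightarrow> 0) at_top"
      using cA by real_asymp
    show "\<forall>\<^sub>F x in at_top. norm (gamma_prim b (a * of_real x) - gamma_prim b (of_real (A * x)))
        \<le> exp (- (c * x)) * ((A * x) powr (b - 1) + (c * x) powr (b - 1)) * (2 * A * x)"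
    proof (rule eventually_mono[OF eventually_gt_at_top[of 0]])
      fix x :: real assume x: "x > 0"
      \<comment> \<open>a convex set that contains both points and on which \<open>norm z\<close> lies between
        \<open>c * x\<close> and \<open>A * x\<close>, so that either sign of \<open>b - 1\<close> can be treated\<close>
      let ?S = "{z. c * x \<le> Re z} \<inter> cball 0 (A * x)"
      let ?B = "exp (- (c * x)) * ((A * x) powr (b - 1) + (c * x) powr (b - 1))"
      have "norm (gamma_prim b (a * of_real x) - gamma_prim b (of_real (A * x)))
          \<le> ?B * norm (a * of_real x - of_real (A * x))"
      proof (rule field_differentiable_bound[where S = ?S])
        show "convex ?S"
          by (intro convex_Int convex_cball convex_halfspace_Re_ge)
        fix z assume z: "z \<in> ?S"
        then have Rez: "Re z > 0" using cA x by (auto intro: less_le_trans[of 0 "c * x"])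
        then show "(gamma_prim b has_field_derivative exp (- z) * z powr of_real (b - 1)) (at z within ?S)"
          by (intro has_field_derivative_at_within[OF gamma_prim_has_field_derivative])
             (auto simp: complex_nonpos_Reals_iff)
        have nz: "c * x \<le> norm z" "norm z \<le> A * x"
          using z complex_Re_le_cmod[of z] by auto
        have "norm z powr (b - 1) \<le> (A * x) powr (b - 1) + (c * x) powr (b - 1)"
        proof (cases "b \<ge> 1")
          case True
          then have "norm z powr (b - 1) \<le> (A * x) powr (b - 1)"
            using nz by (intro powr_mono2) auto
          then show ?thesis by (simp add: add_increasing2)
        next
          case False
          then have "norm z powr (b - 1) \<le> (c * x) powr (b - 1)"
            using nz cA x by (intro powr_mono2') auto
          then show ?thesis by (simp add: add_increasing)
        qed
        moreover have "norm (exp (- z)) \<le> exp (- (c * x))" using z by simp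
        ultimately show "norm (exp (- z) * z powr of_real (b - 1)) \<le> ?B"
          unfolding norm_mult by (intro mult_mono) (auto simp: norm_powr_real_powr')
      next
        show "a * of_real x \<in> ?S" "of_real (A * x) \<in> ?S"
          using cA x by (auto simp: c_def A_def norm_mult complex_Re_le_cmod)
      qed
      also have "\<dots> \<le> ?B * (2 * A * x)"
      proof (intro mult_left_mono)
        have "norm (a * of_real x - of_real (A * x)) \<le> norm (a * of_real x) + norm (of_real (A * x) :: complex)"
          by (rule norm_triangle_ineq4)
        also have "\<dots> = 2 * A * x" using x cA by (simp add: norm_mult A_def)
        finally show "norm (a * of_real x - of_real (A * x)) \<le> 2 * A * x" .
      qed auto
      finally show "norm (gamma_prim b (a * of_real x) - gamma_prim b (of_real (A * x))) \<le> ?B * (2 * A * x)" .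
    qed
  qed
  moreover have "((\<lambda>x. gamma_prim b (of_real (A * x))) \<longlongrightarrow> L) at_top"
    using cA by (intro filterlim_compose[OF lim] filterlim_tendsto_pos_mult_at_top[OF tendsto_const] filterlim_ident)
  ultimately have "((\<lambda>x. (gamma_prim b (a * of_real x) - gamma_prim b (of_real (A * x))) + gamma_prim b (of_real (A * x))) \<longlongrightarrow> 0 + L) at_top"
    by (rule tendsto_add)
  then show ?thesis by simp
qed

section \<open>The generalised exponential series\<close>
lemma vertical_mean_cong:
  "(\<And>z. Re z = x \<Longrightarrow> F z = G z) \<Longrightarrow> vertical_mean F x = vertical_mean G x"
  unfolding vertical_mean_def by (intro Bochner_Integration.integral_cong) auto

lemma powr_le_half_linear:
  fixes c p :: real
  assumes "c \<ge> 0" "0 < p" "p < 1"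
  obtains K where "\<And>r. r \<ge> 0 \<Longrightarrow> c * r powr p \<le> r / 2 + K"
proof -
  have "((\<lambda>r. c * r powr (p - 1)) \<longlongrightarrow> c * 0) at_top"
    using assms by (intro tendsto_mult tendsto_const tendsto_neg_powr filterlim_ident) auto
  then have "\<forall>\<^sub>F r in at_top. c * r powr (p - 1) < 1/2"
    by (rule order_tendstoD) simp
  then have "\<forall>\<^sub>F r in at_top. c * r powr (p - 1) < 1/2 \<and> r > 0"
    by (intro eventually_conj eventually_gt_at_top)
  then obtain R where R: "\<And>r. r \<ge> R \<Longrightarrow> c * r powr (p - 1) < 1/2 \<and> r > 0"
    unfolding eventually_at_top_linorder by metis
  have "c * r powr p \<le> r / 2 + c * \<bar>R\<bar> powr p" if r: "r \<ge> 0" for r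
  proof (cases "r \<ge> R")
    case True
    then have "c * r powr (p - 1) \<le> 1/2" "r > 0" using R[of r] by auto
    then have "c * r powr (p - 1) * r \<le> 1/2 * r" by (intro mult_right_mono) auto
    moreover have "r powr p = r powr (p - 1) * r"
      using \<open>r > 0\<close> by (simp add: powr_diff)
    moreover have "c * \<bar>R\<bar> powr p \<ge> 0" using assms by simp
    ultimately show ?thesis by (simp add: mult.assoc)
  next
    case False
    then have "c * r powr p \<le> c * \<bar>R\<bar> powr p"
      using r assms by (intro mult_left_mono powr_mono2) auto
    then show ?thesis using r by simp
  qed
  then show ?thesis by (rule that)
qed

lemma continuous_on_gamma_prim_term: "continuous_on (- \<real>\<^sub>\<le>\<^sub>0) (gamma_prim_term b k)"
proof (cases "b + real k = 0")
  case True
  then show ?thesis unfolding gamma_prim_term_def by (auto intro!: continuous_intros)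
next
  case False
  then have "of_real (b + real k) \<noteq> (0 :: complex)" by (simp del: of_real_add)
  then show ?thesis
    unfolding gamma_prim_term_def using False
    by (auto intro!: continuous_intros simp: complex_nonpos_Reals_iff simp del: of_real_add)
qed

context
  fixes p w b :: real and a :: complex
  assumes p: "0 < p" "p < 1" and w: "w > 0" and a: "Re a > 0" and b_def: "b = (1 - w) / p"
begin

lemma a_nonzero: "a \<noteq> 0"
  using a by auto

text \<open>
  The arguments of \<open>a\<close> and of \<open>z powr p\<close> are below \<open>\<pi> / 2\<close> in modulus, so the product does
  not cross the cut and principal values multiply without correction.
\<close>
lemma Ln_a_powr:
  assumes z: "Re z > 0"
  shows "Ln (a * z powr of_real p) = Ln a + of_real p * Ln z"
    and "a * z powr of_real p \<notin> \<real>\<^sub>\<le>\<^sub>0"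
proof -
  have z0: "z \<noteq> 0" using z by auto
  have "\<bar>Im (Ln a)\<bar> < pi / 2" "\<bar>Im (Ln z)\<bar> < pi / 2"
    using a z Re_Ln_pos_lt[OF a_nonzero] Re_Ln_pos_lt[OF z0] by blast+
  moreover have "\<bar>p * Im (Ln z)\<bar> \<le> 1 * \<bar>Im (Ln z)\<bar>"
    unfolding abs_mult using p by (intro mult_right_mono) auto
  ultimately have im: "\<bar>Im (Ln a + of_real p * Ln z)\<bar> < pi"
    by simp
  have "exp (Ln a + of_real p * Ln z) = a * z powr of_real p"
    using a_nonzero z0 by (simp add: powr_def exp_add)
  then show eq: "Ln (a * z powr of_real p) = Ln a + of_real p * Ln z"
    using im Ln_exp[of "Ln a + of_real p * Ln z"] by (simp add: abs_less_iff)
  have v0: "a * z powr of_real p \<noteq> 0" using a_nonzero z0 by simp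
  show "a * z powr of_real p \<notin> \<real>\<^sub>\<le>\<^sub>0"
  proof
    assume "a * z powr of_real p \<in> \<real>\<^sub>\<le>\<^sub>0"
    then have "Im (Ln (a * z powr of_real p)) = pi"
      using v0 Im_Ln_eq_pi[OF v0] by (auto simp: complex_nonpos_Reals_iff complex_eq_iff)
    then show False using im unfolding eq by simp
  qed
qed

lemma a_powr_powr:
  assumes z: "Re z > 0"
  shows "(a * z powr of_real p) powr of_real r = a powr of_real r * z powr of_real (p * r)"
proof -
  have "z \<noteq> 0" using z by auto
  then show ?thesis
    using Ln_a_powr(1)[OF z] a_nonzero by (simp add: powr_def[of "_ * _"] powr_def[of a] powr_def[of z "_ * _"] algebra_simps exp_add)
qed

text \<open>
  The substitution \<open>u = a * z powr p\<close> turns an antiderivative of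
  \<open>exp (- a * z powr p) * z powr (- w)\<close> into the incomplete gamma function; \<open>summand_prim_term\<close> are its
  terms as a series in powers of \<open>z\<close>.
\<close>
definition summand_prim_term :: "nat \<Rightarrow> complex \<Rightarrow> complex" where
  "summand_prim_term k z = of_real (1 / p) * a powr of_real (- b) * gamma_prim_term b k (a * z powr of_real p)"

definition summand_prim :: "complex \<Rightarrow> complex" where
  "summand_prim z = of_real (1 / p) * a powr of_real (- b) * gamma_prim b (a * z powr of_real p)"

lemma summand_prim_has_field_derivative:
  assumes z: "Re z > 0"
  shows "(summand_prim has_field_derivative exp (- a * z powr of_real p) * z powr of_real (- w)) (at z)"
proof -
  let ?v = "a * z powr of_real p"
  have z0: "z \<noteq> 0" using z by auto
  have "((\<lambda>z. a * z powr of_real p) has_field_derivative a * (of_real p * z powr (of_real p - 1))) (at z)"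
    using z by (intro DERIV_cmult has_field_derivative_powr) (simp add: complex_nonpos_Reals_iff)
  from DERIV_chain2[OF gamma_prim_has_field_derivative[OF Ln_a_powr(2)[OF z], of b] this]
  have "(summand_prim has_field_derivative of_real (1 / p) * a powr of_real (- b) *
     (exp (- ?v) * ?v powr of_real (b - 1) * (a * (of_real p * z powr (of_real p - 1))))) (at z)"
    unfolding summand_prim_def by (intro DERIV_cmult)
  also have "of_real (1 / p) * a powr of_real (- b) *
     (exp (- ?v) * ?v powr of_real (b - 1) * (a * (of_real p * z powr (of_real p - 1))))
     = exp (- ?v) * (a powr of_real (- b) * a powr of_real (b - 1) * a)
         * (z powr of_real (p * (b - 1)) * z powr of_real (p - 1))"
    unfolding a_powr_powr[OF z] using p by (simp add: field_simps)
  also have "a powr of_real (- b) * a powr of_real (b - 1) * a = 1"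
    using a_nonzero by (simp add: powr_diff powr_minus)
  also have "z powr of_real (p * (b - 1)) * z powr of_real (p - 1) = z powr of_real (- w)"
  proof -
    have "p * (b - 1) + (p - 1) = - w" using p by (simp add: b_def field_simps)
    then show ?thesis by (metis of_real_add powr_add)
  qed
  finally show ?thesis by simp
qed

lemma summand_prim_term_sums: "Re z > 0 \<Longrightarrow> (\<lambda>k. summand_prim_term k z) sums summand_prim z"
  unfolding summand_prim_term_def summand_prim_def using a_nonzero
  by (intro sums_mult gamma_prim_term_sums) auto

text \<open>
  Here \<open>p < 1\<close> is essential: \<open>norm a * norm z powr p\<close> is at most \<open>norm z / 2\<close> up to a constant,
  which keeps the series within the growth that the kernel can absorb.
\<close>
lemma summand_prim_term_bound:
  obtains K where "\<And>z n. Re z \<ge> 1/2 \<Longrightarrow> (\<Sum>k<n. norm (summand_prim_term k z)) \<le> K * exp (norm z)"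
proof -
  obtain C where C: "\<And>z n. z \<noteq> 0 \<Longrightarrow>
    (\<Sum>k<n. norm (gamma_prim_term b k z)) \<le> C * norm z powr b * exp (norm z) + norm (Ln z)"
    by (rule gamma_prim_term_partial_sum_bound[of b]) (rule that)
  obtain K1 where K1: "\<And>z. Re z \<ge> 1/2 \<Longrightarrow> \<bar>b\<bar> * norm (Ln z) \<le> norm z / 2 + K1"
    by (rule Ln_growth[OF abs_ge_zero[of b]]) (rule that)
  obtain K2 where K2: "\<And>r. r \<ge> 0 \<Longrightarrow> norm a * r powr p \<le> r / 2 + K2"
    by (rule powr_le_half_linear[OF norm_ge_zero[of a] p]) (rule that)
  obtain K3 where K3: "\<And>z. Re z \<ge> 1/2 \<Longrightarrow> 1 * norm (Ln z) \<le> norm z / 2 + K3"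
    by (rule Ln_growth[OF zero_le_one]) (rule that)
  define A where "A = norm (of_real (1 / p) * a powr of_real (- b))"
  define L where "L = norm (Ln a)"
  have "(\<Sum>k<n. norm (summand_prim_term k z)) \<le> A * (\<bar>C\<bar> * exp (\<bar>b\<bar> * L + K1 + K2) + exp (L + K3)) * exp (norm z)"
    if z: "Re z \<ge> 1/2" for z n
  proof -
    let ?v = "a * z powr of_real p"
    have z': "Re z > 0" "z \<noteq> 0" using z by auto
    have v0: "?v \<noteq> 0" using a_nonzero z' by simp
    have Lnv: "norm (Ln ?v) \<le> L + norm (Ln z)"
    proof -
      have "norm (of_real p * Ln z) \<le> 1 * norm (Ln z)"
        unfolding norm_mult using p by (intro mult_right_mono) auto
      then show ?thesis
        unfolding Ln_a_powr(1)[OF z'(1)] L_def using norm_triangle_ineq[of "Ln a" "of_real p * Ln z"] by linarith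
    qed
    have "norm ?v powr b = exp (b * Re (Ln ?v))"
      using v0 by (simp add: powr_def)
    also have "\<dots> \<le> exp (\<bar>b\<bar> * norm (Ln ?v))"
    proof -
      have "b * Re (Ln ?v) \<le> \<bar>b\<bar> * \<bar>Re (Ln ?v)\<bar>" by (metis abs_ge_self abs_mult)
      also have "\<dots> \<le> \<bar>b\<bar> * norm (Ln ?v)" by (intro mult_left_mono abs_Re_le_cmod) auto
      finally show ?thesis by simp
    qed
    also have "\<dots> \<le> exp (\<bar>b\<bar> * L + norm z / 2 + K1)"
    proof -
      have "\<bar>b\<bar> * norm (Ln ?v) \<le> \<bar>b\<bar> * (L + norm (Ln z))" by (intro mult_left_mono Lnv) auto
      then show ?thesis using K1[OF z] by (simp add: distrib_left)
    qed
    finally have 1: "norm ?v powr b \<le> exp (\<bar>b\<bar> * L + norm z / 2 + K1)" .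
    have "norm ?v = norm a * norm z powr p"
      by (simp add: norm_mult norm_powr_real_powr')
    then have 2: "exp (norm ?v) \<le> exp (norm z / 2 + K2)"
      using K2[of "norm z"] by simp
    have "norm ?v powr b * exp (norm ?v) \<le> exp (\<bar>b\<bar> * L + norm z / 2 + K1) * exp (norm z / 2 + K2)"
      by (intro mult_mono 1 2) auto
    also have "\<dots> = exp (\<bar>b\<bar> * L + K1 + K2) * exp (norm z)"
      by (simp add: algebra_simps flip: exp_add)
    finally have 3: "norm ?v powr b * exp (norm ?v) \<le> exp (\<bar>b\<bar> * L + K1 + K2) * exp (norm z)" .
    have "norm (Ln ?v) \<le> exp (norm (Ln ?v))" using exp_ge_add_one_self[of "norm (Ln ?v)"] by linarith
    also have "\<dots> \<le> exp (L + K3 + norm z)"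
      using Lnv K3[OF z] norm_ge_zero[of z] by (subst exp_le_cancel_iff) linarith
    finally have 4: "norm (Ln ?v) \<le> exp (L + K3) * exp (norm z)" by (simp flip: exp_add)
    have "(\<Sum>k<n. norm (summand_prim_term k z)) = A * (\<Sum>k<n. norm (gamma_prim_term b k ?v))"
      unfolding summand_prim_term_def A_def norm_mult sum_distrib_left by (simp add: mult.assoc)
    also have "\<dots> \<le> A * (C * norm ?v powr b * exp (norm ?v) + norm (Ln ?v))"
      by (intro mult_left_mono C v0) (simp add: A_def)
    also have "\<dots> \<le> A * (\<bar>C\<bar> * (exp (\<bar>b\<bar> * L + K1 + K2) * exp (norm z)) + exp (L + K3) * exp (norm z))"
    proof (intro mult_left_mono add_mono 4)
      have "C * (norm ?v powr b * exp (norm ?v)) \<le> \<bar>C\<bar> * (exp (\<bar>b\<bar> * L + K1 + K2) * exp (norm z))"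
        by (intro mult_mono 3) auto
      then show "C * norm ?v powr b * exp (norm ?v) \<le> \<bar>C\<bar> * (exp (\<bar>b\<bar> * L + K1 + K2) * exp (norm z))"
        by (simp only: mult.assoc)
    qed (simp add: A_def)
    finally show ?thesis by (simp only: distrib_right distrib_left mult.assoc)
  qed
  then show ?thesis by (rule that)
qed

lemma summand_prim_bound:
  obtains K where "\<And>z. Re z \<ge> 1/2 \<Longrightarrow> norm (summand_prim z) \<le> K * exp (norm z)"
proof -
  obtain K where K: "\<And>z n. Re z \<ge> 1/2 \<Longrightarrow> (\<Sum>k<n. norm (summand_prim_term k z)) \<le> K * exp (norm z)"
    by (rule summand_prim_term_bound) (rule that)
  have "norm (summand_prim z) \<le> K * exp (norm z)" if z: "Re z \<ge> 1/2" for z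
  proof (rule tendsto_upperbound)
    have "(\<lambda>k. summand_prim_term k z) sums summand_prim z" using z by (intro summand_prim_term_sums) auto
    then show "(\<lambda>n. norm (\<Sum>k<n. summand_prim_term k z)) \<longlonglongrightarrow> norm (summand_prim z)"
      unfolding sums_def by (rule tendsto_norm)
    show "\<forall>\<^sub>F n in sequentially. norm (\<Sum>k<n. summand_prim_term k z) \<le> K * exp (norm z)"
      by (intro always_eventually allI order_trans[OF norm_sum K[OF z]])
  qed simp
  then show ?thesis by (rule that)
qed

text \<open>
  Moving from the real point \<open>x\<close> to \<open>x + \<i> * y\<close> changes \<open>z powr p\<close> by at most
  \<open>p * x powr (p - 1) * \<bar>y\<bar>\<close>, and the factor in front of \<open>\<bar>y\<bar>\<close> tends to 0.
\<close>
lemma summand_vertical_bound: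
  assumes x: "x > 0" "norm a * (p * x powr (p - 1)) \<le> 1" and z: "Re z = x"
  shows "norm (exp (- a * z powr of_real p) * z powr of_real (- w)) \<le> x powr (- w) * exp \<bar>Im z\<bar>"
proof -
  have xz: "x \<le> norm z" using complex_Re_le_cmod[of z] z by simp
  have "norm (z powr of_real p - of_real x powr of_real p) \<le> p * x powr (p - 1) * norm (z - of_real x)"
  proof (rule field_differentiable_bound[where S = "{z. x \<le> Re z}"])
    fix u assume u: "u \<in> {z. x \<le> Re z}"
    then have "u \<notin> \<real>\<^sub>\<le>\<^sub>0" using x by (auto simp: complex_nonpos_Reals_iff)
    from has_field_derivative_at_within[OF has_field_derivative_powr[OF this]]
    show "((\<lambda>z. z powr of_real p) has_field_derivative of_real p * u powr (of_real p - 1)) (at u within {z. x \<le> Re z})" .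
    have "x \<le> norm u" using u complex_Re_le_cmod[of u] by auto
    then have "norm u powr (p - 1) \<le> x powr (p - 1)" using x p by (intro powr_mono2') auto
    moreover have "norm (u powr (of_real p - 1)) = norm u powr (p - 1)"
      using norm_powr_real_powr'[of "of_real (p - 1)" u] by simp
    ultimately show "norm (of_real p * u powr (of_real p - 1)) \<le> p * x powr (p - 1)"
      using p by (simp add: norm_mult)
  qed (use z in \<open>auto simp: convex_halfspace_Re_ge\<close>)
  also have "z - of_real x = \<i> * of_real (Im z)" using z by (simp add: complex_eq_iff)
  finally have d: "norm (z powr of_real p - of_real x powr of_real p) \<le> p * x powr (p - 1) * \<bar>Im z\<bar>"
    by (simp add: norm_mult)
  have "norm (a * (z powr of_real p - of_real x powr of_real p)) \<le> norm a * (p * x powr (p - 1) * \<bar>Im z\<bar>)"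
    unfolding norm_mult by (intro mult_left_mono d) auto
  also have "\<dots> = norm a * (p * x powr (p - 1)) * \<bar>Im z\<bar>" by (simp add: mult_ac)
  also have "\<dots> \<le> 1 * \<bar>Im z\<bar>" by (intro mult_right_mono x) auto
  finally have "\<bar>Re (a * (z powr of_real p - of_real x powr of_real p))\<bar> \<le> \<bar>Im z\<bar>"
    using abs_Re_le_cmod order_trans by fastforce
  moreover have "Re (a * (z powr of_real p - of_real x powr of_real p)) = Re (a * z powr of_real p) - Re a * x powr p"
    using x powr_of_real[of x p] by (simp add: right_diff_distrib)
  moreover have "Re a * x powr p \<ge> 0" using a by simp
  ultimately have "- Re (a * z powr of_real p) \<le> \<bar>Im z\<bar>" by linarith
  then have "norm (exp (- a * z powr of_real p)) \<le> exp \<bar>Im z\<bar>" by simp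
  moreover have "norm (z powr of_real (- w)) \<le> x powr (- w)"
    unfolding norm_powr_real_powr'[OF Reals_of_real] using xz x w by (auto intro!: powr_mono2')
  ultimately show ?thesis
    unfolding norm_mult by (subst mult.commute) (intro mult_mono, auto)
qed

lemma sum_tendsto:
  assumes L: "((\<lambda>x. gamma_prim b (a * of_real x)) \<longlongrightarrow> L) at_top"
  shows "(\<lambda>n. exp (- a * of_real (real (Suc n) powr p)) / of_real (real (Suc n) powr w))
           sums (of_real (1 / p) * a powr of_real (- b) * L - vertical_mean summand_prim (1/2))"
proof -
  let ?f = "\<lambda>z. exp (- a * z powr of_real p) * z powr of_real (- w)"
  obtain K where K: "\<And>z. Re z \<ge> 1/2 \<Longrightarrow> norm (summand_prim z) \<le> K * exp (norm z)"
    by (rule summand_prim_bound) (rule that)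
  have "(\<lambda>N. (\<Sum>n<N. ?f (of_nat (Suc n))) - summand_prim (of_real (real N + 1/2))) \<longlonglongrightarrow> - vertical_mean summand_prim (1/2)"
  proof (rule sum_minus_antiderivative_tendsto)
    show "(summand_prim has_field_derivative ?f z) (at z)" if "Re z > 0" for z
      using that by (rule summand_prim_has_field_derivative)
    show "norm (summand_prim z) \<le> K * exp (norm z)" if "Re z \<ge> 1/2" for z
      using that by (rule K)
    have "(\<lambda>N. norm a * (p * (real N + 1/2) powr (p - 1))) \<longlonglongrightarrow> norm a * (p * 0)"
      using p by (intro tendsto_intros) real_asymp
    then have "\<forall>\<^sub>F N in sequentially. norm a * (p * (real N + 1/2) powr (p - 1)) < 1"
      by (rule order_tendstoD) simp
    then show "\<forall>\<^sub>F N in sequentially. \<forall>z. Re z = real N + 1/2 \<longrightarrow>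
        norm (?f z) \<le> (real N + 1/2) powr (- w) * exp \<bar>Im z\<bar>"
      by (rule eventually_mono) (intro allI impI summand_vertical_bound, auto)
    show "(\<lambda>N. (real N + 1/2) powr (- w)) \<longlonglongrightarrow> 0" using w by real_asymp
  qed
  moreover have "(\<lambda>N. summand_prim (of_real (real N + 1/2))) \<longlonglongrightarrow> of_real (1 / p) * a powr of_real (- b) * L"
  proof -
    have "filterlim (\<lambda>N. (real N + 1/2) powr p) at_top sequentially" using p by real_asymp
    from filterlim_compose[OF L this]
    have "(\<lambda>N. of_real (1 / p) * a powr of_real (- b) * gamma_prim b (a * of_real ((real N + 1/2) powr p)))
        \<longlonglongrightarrow> of_real (1 / p) * a powr of_real (- b) * L"
      by (intro tendsto_intros)
    moreover have "(of_real (real N + 1/2) :: complex) powr of_real p = of_real ((real N + 1/2) powr p)" for N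
      by (intro powr_of_real) simp
    ultimately show ?thesis by (simp only: summand_prim_def)
  qed
  ultimately have "(\<lambda>N. ((\<Sum>n<N. ?f (of_nat (Suc n))) - summand_prim (of_real (real N + 1/2))) + summand_prim (of_real (real N + 1/2)))
      \<longlonglongrightarrow> - vertical_mean summand_prim (1/2) + of_real (1 / p) * a powr of_real (- b) * L"
    by (rule tendsto_add)
  moreover have "?f (of_nat (Suc n)) = exp (- a * of_real (real (Suc n) powr p)) / of_real (real (Suc n) powr w)" for n
  proof -
    have "(of_nat (Suc n) :: complex) powr of_real r = of_real (real (Suc n) powr r)" for r
      using powr_of_real[of "real (Suc n)" r] by (simp del: of_nat_Suc)
    then show ?thesis by (simp only: powr_minus of_real_inverse divide_inverse)
  qed
  ultimately show ?thesis by (simp add: sums_def)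
qed

text \<open>
  Each term of the antiderivative is a constant times \<open>z powr (1 - s) / (1 - s)\<close> with
  \<open>s = w - k * p\<close>, whose mean is \<open>- zeta s\<close> by Jensen's formula; the exceptional term is
  logarithmic and contributes Euler's constant.
\<close>
lemma vertical_mean_summand_prim_term:
  "vertical_mean (summand_prim_term k) (1/2) =
     (if b + real k = 0 then (- a) ^ k / fact k * (of_real (1 / p) * Ln a - euler_mascheroni) else 0)
     - (if w = p * real k + 1 then 0 else (-1) ^ k / fact k * zeta (of_real (w - real k * p)) * a ^ k)"
proof -
  have res: "b + real k = 0 \<longleftrightarrow> w = p * real k + 1"
    using p by (auto simp: b_def field_simps)
  have ak: "a powr of_real (- b) * a powr of_real (b + real k) = a ^ k"
    using a_nonzero powr_add[of a "of_real (- b)" "of_real (b + real k)"] by simp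
  show ?thesis
  proof (cases "b + real k = 0")
    case True
    have "summand_prim_term k z = (- a) ^ k / fact k * (of_real (1 / p) * Ln a) + (- a) ^ k / fact k * Ln z" if z: "Re z = 1/2" for z
    proof -
      have "a powr of_real (- b) = a ^ k" using ak True a_nonzero by simp
      then show ?thesis
        unfolding summand_prim_term_def gamma_prim_term_def using True p z
        by (simp add: Ln_a_powr(1) power_minus[of a] field_simps)
    qed
    then have "vertical_mean (summand_prim_term k) (1/2) = vertical_mean (\<lambda>z. (- a) ^ k / fact k * (of_real (1 / p) * Ln a) + (- a) ^ k / fact k * Ln z) (1/2)"
      by (rule vertical_mean_cong)
    also have "\<dots> = (- a) ^ k / fact k * (of_real (1 / p) * Ln a) + (- a) ^ k / fact k * vertical_mean Ln (1/2)"
    proof -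
      have "integrable sech_measure (\<lambda>y. Ln (Complex (1/2) y))"
        by (rule tame_integrable[OF tame_Ln]) simp
      from Bochner_Integration.integral_add[OF sech_measure_const(1) integrable_mult_right[OF this]]
      show ?thesis
        unfolding vertical_mean_def by (simp only: sech_measure_const(2) integral_mult_right_zero)
    qed
    finally have "vertical_mean (summand_prim_term k) (1/2) = (- a) ^ k / fact k * (of_real (1 / p) * Ln a - euler_mascheroni)"
      unfolding vertical_mean_Ln by (simp only: right_diff_distrib mult_minus_right) simp
    moreover have "w = p * real k + 1" using True res by blast
    ultimately show ?thesis using True by (simp only: if_True diff_zero simp_thms)
  next
    case False
    define s where "s = (of_real (w - real k * p) :: complex)"
    have s1: "s \<noteq> 1" 
    proof
      assume "s = 1"
      then have "w - real k * p = 1" unfolding s_def by (metis of_real_eq_1_iff)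
      then show False using False res by (simp add: mult.commute)
    qed
    have bk: "of_real p * of_real (b + real k) = 1 - s"
      using p by (simp add: s_def b_def field_simps flip: of_real_mult)
    have "summand_prim_term k z = (-1) ^ k / fact k * a ^ k / (1 - s) * z powr (1 - s)" if z: "Re z = 1/2" for z
    proof -
      have "(a * z powr of_real p) powr of_real (b + real k) = a powr of_real (b + real k) * z powr (1 - s)"
        using a_powr_powr[of z "b + real k"] z bk by simp
      then have "summand_prim_term k z = (-1) ^ k / fact k * (a powr of_real (- b) * a powr of_real (b + real k))
          * z powr (1 - s) / (of_real p * of_real (b + real k))"
        using False by (simp add: summand_prim_term_def gamma_prim_term_def mult_ac del: of_real_add)
      then show ?thesis unfolding ak bk by simp
    qed
    then have "vertical_mean (summand_prim_term k) (1/2) = vertical_mean (\<lambda>z. (-1) ^ k / fact k * a ^ k / (1 - s) * z powr (1 - s)) (1/2)"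
      by (rule vertical_mean_cong)
    also have "\<dots> = (-1) ^ k / fact k * a ^ k / (1 - s) * vertical_mean (\<lambda>z. z powr (1 - s)) (1/2)"
      unfolding vertical_mean_def by (rule integral_mult_right_zero)
    also have "vertical_mean (\<lambda>z. z powr (1 - s)) (1/2) = zeta s * (s - 1)"
      using zeta_eq_vertical_mean[OF s1] s1 by simp
    also have "(-1) ^ k / fact k * a ^ k / (1 - s) * (zeta s * (s - 1)) = - ((-1) ^ k / fact k * zeta s * a ^ k)"
      using s1 by (simp add: divide_simps) (simp add: algebra_simps)
    finally show ?thesis using False res by (simp add: s_def)
  qed
qed

lemma vertical_mean_summand_prim_sums: "(\<lambda>k. vertical_mean (summand_prim_term k) (1/2)) sums vertical_mean summand_prim (1/2)"
proof -
  obtain K where K: "\<And>z n. Re z \<ge> 1/2 \<Longrightarrow> (\<Sum>k<n. norm (summand_prim_term k z)) \<le> K * exp (norm z)"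
    by (rule summand_prim_term_bound) (rule that)
  have K0: "K \<ge> 0"
    using K[of 1 0] by (simp add: zero_le_mult_iff)
  show ?thesis
  proof (rule vertical_mean_sums)
    show "continuous_on {z. Re z > 0} (summand_prim_term k)" for k
    proof -
      have "continuous_on {z. Re z > 0} (\<lambda>z. a * z powr of_real p)"
        by (intro continuous_intros) (auto simp: complex_nonpos_Reals_iff)
      then show ?thesis
        unfolding summand_prim_term_def using Ln_a_powr(2)
        by (intro continuous_intros continuous_on_compose2[OF continuous_on_gamma_prim_term]) auto
    qed
    show "(\<lambda>k. summand_prim_term k z) sums summand_prim z" if "Re z = 1/2" for z
      using that by (intro summand_prim_term_sums) simp
    show "(\<Sum>k<n. norm (summand_prim_term k z)) \<le> (K * exp 1) * exp (2 * \<bar>Im z\<bar>)" if z: "Re z = 1/2" for n z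
    proof -
      have "norm z \<le> 1 + 2 * \<bar>Im z\<bar>" using cmod_le[of z] z by simp
      then have "K * exp (norm z) \<le> K * exp (1 + 2 * \<bar>Im z\<bar>)"
        using K0 by (intro mult_left_mono) auto
      then show ?thesis using K[of z n] z by (simp add: exp_add mult.assoc)
    qed
  qed simp
qed

end

theorem mainTheorem3:
  fixes p w :: real and a :: complex
  assumes "0 < p" and "p < 1" and "w > 0"
    and "a \<noteq> 0" and "\<bar>Arg a\<bar> < pi / 2"
  defines "t \<equiv> (\<lambda>k::nat. if w = p * real k + 1 then 0
                    else (- 1) ^ k / fact k * zeta (of_real (w - real k * p)) * a ^ k)"
  shows "summable t \<and>
    (\<lambda>n. exp (- a * of_real (real (Suc n) powr p)) / of_real (real (Suc n) powr w))
      sums (J p a w + (\<Sum>k. t k))"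
proof -
  define b where "b = (1 - w) / p"
  have Re_a: "Re a > 0"
    using assms(4,5) Re_Ln_pos_lt[of a] by (simp add: Arg_eq_Im_Ln)
  note ctx = assms(1-3) Re_a b_def
  have res: "b + real k = 0 \<longleftrightarrow> w = p * real k + 1" for k
    using assms(1) by (auto simp: b_def field_simps)
  \<comment> \<open>\<open>I\<close> collects the contribution of the exceptional index, if there is one\<close>
  define E where "E = (\<lambda>k::nat. (- a) ^ k / fact k * (of_real (1 / p) * Ln a - euler_mascheroni))"
  define I where "I = (\<Sum>k. if b + real k = 0 then E k else 0)"
  define V where "V = vertical_mean (summand_prim p b a) (1/2)"
  have "(\<lambda>k. (if b + real k = 0 then E k else 0) - t k) sums V"
    using vertical_mean_summand_prim_sums[OF ctx] unfolding vertical_mean_summand_prim_term[OF ctx] E_def t_def V_def .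
  from sums_diff[OF indicator_sums[of b E] this]
  have t_sums: "t sums (I - V)" by (simp add: I_def)
  obtain L where L: "((\<lambda>x. gamma_prim b (of_real x)) \<longlongrightarrow> L) at_top"
    and JL: "J p a w = of_real (1 / p) * a powr of_real (- b) * L - I"
  proof (cases "\<forall>M::nat. w \<noteq> p * real M + 1")
    case True
    then have nz: "b + real M \<noteq> 0" for M using res by blast
    show ?thesis
    proof (rule that[OF gamma_prim_tendsto_Gamma[OF nz]])
      have "- b = (w - 1) / p" by (simp add: b_def diff_divide_distrib)
      then show "J p a w = of_real (1 / p) * a powr of_real (- b) * Gamma (of_real b) - I"
        using True nz by (simp add: J_def I_def b_def)
    qed
  next
    case False
    then obtain M :: nat where M: "w = p * real M + 1" by blast
    then have bM: "b = - real M" using res[of M] by simp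
    show ?thesis
    proof (rule that)
      show "((\<lambda>x. gamma_prim b (of_real x)) \<longlongrightarrow> (-1) ^ M / fact M * Digamma (of_nat (M + 1))) at_top"
        unfolding bM by (rule gamma_prim_tendsto_Digamma)
      have "(THE M::nat. w = p * real M + 1) = M"
        using M assms(1) by (intro the_equality) auto
      then have J: "J p a w = (- a) ^ M / fact M *
          (euler_mascheroni - 1 / of_real p * Ln a + 1 / of_real p * Digamma (of_nat (M + 1)))"
        using M by (auto simp: J_def Let_def)
      have "(\<lambda>k. if b + real k = 0 then E k else 0) = (\<lambda>k. if k = M then E k else 0)"
        by (auto simp: bM)
      then have "I = E M"
        unfolding I_def using sums_single[of M E] by (simp add: sums_iff)
      moreover have "a powr of_real (- b) = a ^ M"
        using assms(4) by (simp add: bM powr_nat')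
      ultimately show "J p a w = of_real (1 / p) * a powr of_real (- b) * ((-1) ^ M / fact M * Digamma (of_nat (M + 1))) - I"
        unfolding J E_def power_minus[of a] by (simp add: divide_inverse algebra_simps del: of_nat_Suc of_nat_add)
    qed
  qed
  have "(\<lambda>n. exp (- a * of_real (real (Suc n) powr p)) / of_real (real (Suc n) powr w))
      sums (of_real (1 / p) * a powr of_real (- b) * L - V)"
    unfolding V_def by (rule sum_tendsto[OF ctx gamma_prim_tendsto_along_ray[OF Re_a L]])
  also have "of_real (1 / p) * a powr of_real (- b) * L - V = J p a w + (\<Sum>k. t k)"
    using t_sums by (simp add: JL sums_iff)
  finally show ?thesis using t_sums by (simp add: sums_iff)
qed

end
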